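(* Let $U$ be a flow in class $\mathcal{K}^{+}$ on $[y_1,y_2]$, let $\beta\in(\min U'',\max U'')$, and let $(\phi_s,\alpha_s,\beta,c_s)$ be a neutral limiting mode. Then $c_s$ satisfies one of the following: (i) $c_s=U_{\beta}$; (ii) $c_s=U(y_1)$ or $c_s=U(y_2)$; (iii) $c_s$ is a critical value of $U$; (iv) $c_s\notin\mathrm{Ran}(U)$.
   Context: Class $\mathcal{K}^+$: $U\in C^{3}([y_1,y_2])$ is not constant, and for each $\beta\in\mathrm{Ran}(U'')$ there exists $U_\beta\in\mathrm{Ran}(U)$ such that $K_\beta(y)=\frac{\beta-U''(y)}{U(y)-U_\beta}$ is positive and bounded on $[y_1,y_2]$. An unstable mode $(c,\alpha,\beta,\phi)$ is a nontrivial solution of the Rayleigh–Kuo problem $-\phi''+\alpha^2\phi-\frac{\beta-U''}{U-c}\phi=0$ on $(y_1,y_2)$, $\phi(y_1)=\phi(y_2)=0$, with $\alpha>0$ and $\operatorname{Im}c>0$. For $\beta\in(\min U'',\max U'')$, $(c_s,\alpha_s,\beta,\phi_s)$ is a neutral limiting mode if $c_s\in\mathbb{R}$, $\alpha_s>0$, and there is a sequence of unstable modes $(c_k,\alpha_k,\beta,\phi_k)$ with $\operatorname{Im}c_k>0$, $\|\phi_k\|_{L^2}=1$, $c_k\to c_s$, $\alpha_k\to\alpha_s$, $\phi_k\to\phi_s$ uniformly on compact subsets of $S_0:=[y_1,y_2]\setminus\{U=c_s\}$, $\phi_s''$ exists on $S_0$, and $(U-c_s)(-\phi_s''+\alpha_s^2\phi_s)-(\beta-U'')\phi_s=0$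 on $S_0$. *)

theory Defs
  imports "HOL-Analysis.Analysis"
begin

definition C3_derivs :: "real \<Rightarrow> real \<Rightarrow> (real \<Rightarrow> real) \<Rightarrow> (real \<Rightarrow> real) \<Rightarrow> (real \<Rightarrow> real) \<Rightarrow> bool" where
  "C3_derivs a b U U1 U2 \<longleftrightarrow>
     (\<exists>U3. (\<forall>y\<in>{a..b}.
              (U has_real_derivative U1 y) (at y within {a..b}) \<and>
              (U1 has_real_derivative U2 y) (at y within {a..b}) \<and>
              (U2 has_real_derivative U3 y) (at y within {a..b})) \<and>
           continuous_on {a..b} U3)"

text \<open>K_beta(y) = (beta - U''(y)) / (U(y) - u) is positive and bounded on [a,b]
  (at the points where U(y) = u the quotient is not defined pointwise and is
  not constrained).\<close>
definition K_beta_pos_bdd :: "real \<Rightarrow> real \<Rightarrow> (real \<Rightarrow> real) \<Rightarrow> (real \<Rightarrow> real) \<Rightarrow> real \<Rightarrow> real \<Rightarrow> bool" where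
  "K_beta_pos_bdd a b U U2 \<beta> u \<longleftrightarrow>
     (\<forall>y\<in>{a..b}. U y \<noteq> u \<longrightarrow> 0 < (\<beta> - U2 y) / (U y - u)) \<and>
     (\<exists>M. \<forall>y\<in>{a..b}. U y \<noteq> u \<longrightarrow> \<bar>(\<beta> - U2 y) / (U y - u)\<bar> \<le> M)"

definition class_K_plus :: "real \<Rightarrow> real \<Rightarrow> (real \<Rightarrow> real) \<Rightarrow> (real \<Rightarrow> real) \<Rightarrow> (real \<Rightarrow> real) \<Rightarrow> bool" where
  "class_K_plus a b U U1 U2 \<longleftrightarrow>
     C3_derivs a b U U1 U2 \<and>
     (\<exists>y\<in>{a..b}. \<exists>z\<in>{a..b}. U y \<noteq> U z) \<and>
     (\<forall>\<beta>\<in>U2 ` {a..b}. \<exists>u\<in>U ` {a..b}. K_beta_pos_bdd a b U U2 \<beta> u)"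

text \<open>Unstable mode (c, alpha, beta, phi) of the Rayleigh--Kuo problem.\<close>
definition unstable_mode :: "real \<Rightarrow> real \<Rightarrow> (real \<Rightarrow> real) \<Rightarrow> (real \<Rightarrow> real) \<Rightarrow>
    complex \<Rightarrow> real \<Rightarrow> real \<Rightarrow> (real \<Rightarrow> complex) \<Rightarrow> bool" where
  "unstable_mode a b U U2 c \<alpha> \<beta> \<phi> \<longleftrightarrow>
     \<alpha> > 0 \<and> Im c > 0 \<and>
     continuous_on {a..b} \<phi> \<and> \<phi> a = 0 \<and> \<phi> b = 0 \<and>
     (\<exists>y\<in>{a..b}. \<phi> y \<noteq> 0) \<and>
     (\<exists>\<phi>1 \<phi>2. \<forall>y\<in>{a<..<b}.
        (\<phi> has_vector_derivative \<phi>1 y) (at y) \<and>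
        (\<phi>1 has_vector_derivative \<phi>2 y) (at y) \<and>
        - \<phi>2 y + complex_of_real (\<alpha>\<^sup>2) * \<phi> y
          - complex_of_real (\<beta> - U2 y) / (complex_of_real (U y) - c) * \<phi> y = 0)"

definition neutral_limiting_mode :: "real \<Rightarrow> real \<Rightarrow> (real \<Rightarrow> real) \<Rightarrow> (real \<Rightarrow> real) \<Rightarrow>
    real \<Rightarrow> real \<Rightarrow> real \<Rightarrow> (real \<Rightarrow> complex) \<Rightarrow> bool" where
  "neutral_limiting_mode a b U U2 cs \<alpha>s \<beta> \<phi>s \<longleftrightarrow>
     \<alpha>s > 0 \<and>
     (let S0 = {a..b} - {y. U y = cs} in
      (\<exists>c :: nat \<Rightarrow> complex. \<exists>\<alpha> :: nat \<Rightarrow> real. \<exists>\<phi> :: nat \<Rightarrow> real \<Rightarrow> complex.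
         (\<forall>k. unstable_mode a b U U2 (c k) (\<alpha> k) \<beta> (\<phi> k)) \<and>
         (\<forall>k. integral {a..b} (\<lambda>y. (cmod (\<phi> k y))\<^sup>2) = 1) \<and>
         c \<longlonglongrightarrow> complex_of_real cs \<and>
         \<alpha> \<longlonglongrightarrow> \<alpha>s \<and>
         (\<forall>K. compact K \<and> K \<subseteq> S0 \<longrightarrow> uniform_limit K \<phi> \<phi>s sequentially)) \<and>
      (\<exists>\<phi>1 \<phi>2. \<forall>y\<in>S0.
         (\<phi>s has_vector_derivative \<phi>1 y) (at y within S0) \<and>
         (\<phi>1 has_vector_derivative \<phi>2 y) (at y within S0) \<and>
         complex_of_real (U y - cs) * (- \<phi>2 y + complex_of_real (\<alpha>s\<^sup>2) * \<phi>s y)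
           - complex_of_real (\<beta> - U2 y) * \<phi>s y = 0))"

end

theory Submission
  imports Defs "HOL-Complex_Analysis.Great_Picard"
begin

text \<open>
  Suppose \<open>cs\<close> is a regular value of \<open>U\<close> attained only in the interior, and \<open>cs \<noteq> u\<close> with \<open>u = U\<^sub>\<beta>\<close>.
  Integrating \<open>(\<phi>' cnj \<phi>)'\<close> over the interval and combining real and imaginary part so that the
  factor \<open>U - Re c\<close> becomes \<open>U - 2 Re c + u\<close> yields a bound on the \<open>L\<^sup>2\<close> norm of
  \<open>(\<beta> - U'') / (U - c) \<phi>\<close>, because
  \<open>(\<beta> - U'') (U - 2 Re c + u) = K\<^sub>\<beta> ((U - Re c)\<^sup>2 - (u - Re c)\<^sup>2)\<close>
  and \<open>u - Re c\<close> stays away from 0. So the unstable modes are bounded in \<open>H\<^sup>2\<close>, and a subsequence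
  converges in \<open>C\<^sup>1\<close> to a nonzero \<open>\<Phi>\<close> which vanishes at both ends and, again by the weighted bound, at all
  roots of \<open>U - cs\<close>. As \<open>U - cs\<close> changes sign at a root, some interval between consecutive roots or ends
  has \<open>\<beta> (U - cs) \<le> 0\<close>; comparing with \<open>U - cs\<close> itself shows that \<open>\<Phi>\<close> vanishes there.
  Unique continuation across the roots, where the coefficient is only of size \<open>1/\<bar>y - z\<bar>\<close>, then
  forces \<open>\<Phi> = 0\<close>.
\<close>

section \<open>The singular boundary value problem\<close>

text \<open>The mean value theorem for endpoints in either order, with derivatives asked for only
  strictly between them. Estimates can therefore start at a base point where the second-order
  equation is singular.\<close>

lemma abs_diff_le_open_segment:
  fixes f :: "real \<Rightarrow> real"
  assumes "continuous_on (closed_segment p q) f"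
    and der: "\<And>x. x \<in> open_segment p q \<Longrightarrow> (f has_real_derivative f' x) (at x)"
    and bd: "\<And>x. x \<in> open_segment p q \<Longrightarrow> \<bar>f' x\<bar> \<le> B"
  shows "\<bar>f q - f p\<bar> \<le> B * \<bar>q - p\<bar>"
proof -
  have *: "\<bar>f t - f s\<bar> \<le> B * \<bar>t - s\<bar>" if "s < t" "closed_segment p q = {s..t}" "open_segment p q = {s<..<t}" for s t
  proof -
    have "continuous_on {s..t} f" using assms(1) that by simp
    moreover have "(f has_derivative (\<lambda>h. f' x * h)) (at x)" if "s < x" "x < t" for x
      using der[of x] that \<open>open_segment p q = _\<close> by (simp add: has_field_derivative_def)
    ultimately obtain x where x: "x \<in> {s<..<t}" "f t - f s = f' x * (t - s)"
      using mvt[OF \<open>s < t\<close>, of f "\<lambda>x h. f' x * h"] by auto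
    have "\<bar>f' x\<bar> \<le> B" using bd x that by auto
    then show ?thesis unfolding x(2) abs_mult by (rule mult_right_mono) simp
  qed
  consider "p < q" | "q < p" | "p = q" by linarith
  then show ?thesis
  proof cases
    case 1 then show ?thesis
      using *[of p q] by (auto simp: closed_segment_eq_real_ivl open_segment_eq_real_ivl)
  next
    case 2 then show ?thesis
      using *[of q p] by (auto simp: closed_segment_eq_real_ivl open_segment_eq_real_ivl abs_minus_commute)
  qed simp
qed

text \<open>On the segment from \<open>y0\<close> to \<open>y\<close> let \<open>m\<close> be the maximum of \<open>\<bar>g\<bar>\<close>. Then
  \<open>\<bar>h s\<bar> \<le> m \<bar>s - y0\<bar>\<close>, which absorbs the singular factor and gives \<open>m \<le> C \<epsilon> m\<close>.\<close>
lemma singular_ode_local_uniqueness: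
  fixes h g g2 :: "real \<Rightarrow> real"
  assumes h: "\<And>y. y \<in> {a..b} \<Longrightarrow> (h has_real_derivative g y) (at y within {a..b})"
    and g: "continuous_on {a..b} g"
    and y0: "y0 \<in> {a..b}" "h y0 = 0" "g y0 = 0" and "\<delta> > 0"
    and der: "\<And>y. \<lbrakk>y \<in> {a<..<b}; y \<noteq> y0; \<bar>y - y0\<bar> < \<delta>\<rbrakk> \<Longrightarrow> (g has_real_derivative g2 y) (at y)"
    and bd: "\<And>y. \<lbrakk>y \<in> {a<..<b}; y \<noteq> y0; \<bar>y - y0\<bar> < \<delta>\<rbrakk> \<Longrightarrow> \<bar>g2 y\<bar> \<le> C / \<bar>y - y0\<bar> * \<bar>h y\<bar>"
  shows "\<exists>\<epsilon>>0. \<forall>y\<in>{a..b}. \<bar>y - y0\<bar> < \<epsilon> \<longrightarrow> h y = 0 \<and> g y = 0"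
proof -
  \<comment> \<open>With \<open>D \<ge> 1\<close> the radius \<open>1 / (2 * D)\<close> is positive
    whatever the sign of \<open>C\<close>, and \<open>D * \<epsilon> \<le> 1/2\<close> will turn the
    estimate into \<open>m \<le> m / 2\<close>.\<close>
  define D where "D = max C 1"
  have D: "D \<ge> C" "D \<ge> 1" by (auto simp: D_def)
  define \<epsilon> where "\<epsilon> = min \<delta> (1 / (2 * D))"
  have eps: "\<epsilon> > 0" "\<epsilon> \<le> \<delta>" "D * \<epsilon> \<le> 1/2"
    using D \<open>\<delta> > 0\<close> by (auto simp: \<epsilon>_def min_def field_simps)
  have "h y = 0 \<and> g y = 0" if y: "y \<in> {a..b}" "\<bar>y - y0\<bar> < \<epsilon>" for y
  proof -
    let ?J = "closed_segment y0 y"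
    have J: "?J \<subseteq> {a..b}" using y y0 by (simp add: closed_segment_subset)
    have Jd: "\<bar>s - y0\<bar> \<le> \<bar>y - y0\<bar>" if "s \<in> ?J" for s
      using that by (auto simp: closed_segment_eq_real_ivl split: if_splits)
    have Js: "closed_segment y0 s \<subseteq> ?J" "open_segment y0 s \<subseteq> ?J" if "s \<in> ?J" for s
      using that by (auto simp: closed_segment_eq_real_ivl open_segment_eq_real_ivl split: if_splits)
    have Ji: "s \<in> {a<..<b}" "s \<noteq> y0" "s \<in> ?J" if "s \<in> open_segment y0 t" "t \<in> ?J" for s t
      using that y y0 by (auto simp: closed_segment_eq_real_ivl open_segment_eq_real_ivl split: if_splits)
    have "continuous_on ?J (\<lambda>s. \<bar>g s\<bar>)"
      by (intro continuous_intros continuous_on_subset[OF g J])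
    then obtain t where t: "t \<in> ?J" "\<And>s. s \<in> ?J \<Longrightarrow> \<bar>g s\<bar> \<le> \<bar>g t\<bar>"
      using continuous_attains_sup[of ?J "\<lambda>s. \<bar>g s\<bar>"] by auto
    define m where "m = \<bar>g t\<bar>"
    have contg: "continuous_on (closed_segment y0 s) g" if "s \<in> ?J" for s
      using continuous_on_subset[OF g] J Js[OF that] by blast
    have conth: "continuous_on {a..b} h"
      using h by (meson DERIV_continuous continuous_on_eq_continuous_within)
    have hb: "\<bar>h s\<bar> \<le> m * \<bar>s - y0\<bar>" if s: "s \<in> ?J" for s
    proof -
      have "\<bar>h s - h y0\<bar> \<le> m * \<bar>s - y0\<bar>"
      proof (rule abs_diff_le_open_segment)
        show "continuous_on (closed_segment y0 s) h"
          using continuous_on_subset[OF conth] J Js[OF s] by blast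
        fix x assume x: "x \<in> open_segment y0 s"
        then have "x \<in> {a<..<b}" using Ji s by blast
        then show "(h has_real_derivative g x) (at x)"
          using h[of x] at_within_Icc_at[of a x b] by auto
        show "\<bar>g x\<bar> \<le> m" using t Js[OF s] x by (auto simp: m_def)
      qed
      then show ?thesis using y0 by simp
    qed
    have "\<bar>g t - g y0\<bar> \<le> (D * m) * \<bar>t - y0\<bar>"
    proof (rule abs_diff_le_open_segment[OF contg[OF t(1)]])
      fix x assume x: "x \<in> open_segment y0 t"
      note xx = Ji[OF x t(1)]
      have d: "\<bar>x - y0\<bar> < \<delta>" using Jd[OF xx(3)] y eps by linarith
      show "(g has_real_derivative g2 x) (at x)" using der xx d by blast
      have "\<bar>g2 x\<bar> \<le> C / \<bar>x - y0\<bar> * \<bar>h x\<bar>" using bd xx d by blast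
      also have "\<dots> \<le> D / \<bar>x - y0\<bar> * (m * \<bar>x - y0\<bar>)"
        using D hb[OF xx(3)] by (intro mult_mono divide_right_mono) auto
      also have "\<dots> = D * m" using xx by simp
      finally show "\<bar>g2 x\<bar> \<le> D * m" .
    qed
    also have "\<dots> \<le> D * m * \<epsilon>"
      using Jd[OF t(1)] y D by (intro mult_left_mono) (auto simp: m_def)
    also have "\<dots> = (D * \<epsilon>) * m" by simp
    also have "\<dots> \<le> 1/2 * m" using eps by (intro mult_right_mono) (auto simp: m_def)
    finally have "m = 0" using y0 by (simp add: m_def)
    then show ?thesis using hb[of y] t(2)[of y] by (auto simp: m_def)
  qed
  then show ?thesis using eps by blast
qed

section \<open>Comparison with \<open>U - c\<close> between neighbouring roots\<close>

text \<open>Near a simple zero a function is at least linear in the distance to it. The case of a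
  nonzero value is put in the same form by means of \<open>\<delta> \<le> 1\<close>, so that
  \<open>1 / \<bar>U - c\<bar>\<close> is bounded by a multiple of
  \<open>1 / \<bar>y - y0\<bar>\<close> near every point, root or not.\<close>

lemma abs_ge_linear_near:
  fixes U :: "real \<Rightarrow> real"
  assumes "(U has_real_derivative D) (at y0 within S)" and nz: "U y0 \<noteq> 0 \<or> D \<noteq> 0"
  shows "\<exists>m>0. \<exists>\<delta>>0. \<delta> \<le> 1 \<and> (\<forall>y\<in>S. \<bar>y - y0\<bar> < \<delta> \<longrightarrow> m * \<bar>y - y0\<bar> \<le> \<bar>U y\<bar>)"
proof (cases "U y0 = 0")
  case False
  have "continuous (at y0 within S) U" using assms(1) by (rule DERIV_continuous)
  then have "\<forall>e>0. \<exists>d>0. \<forall>x'\<in>S. dist x' y0 < d \<longrightarrow> dist (U x') (U y0) < e"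
    by (simp add: continuous_within_eps_delta)
  then obtain d where d: "d > 0" "\<And>x'. x' \<in> S \<Longrightarrow> dist x' y0 < d \<Longrightarrow> dist (U x') (U y0) < \<bar>U y0\<bar>/2"
    using False by (metis half_gt_zero zero_less_abs_iff)
  have "\<forall>y\<in>S. \<bar>y - y0\<bar> < min d 1 \<longrightarrow> \<bar>U y0\<bar>/2 * \<bar>y - y0\<bar> \<le> \<bar>U y\<bar>"
  proof (intro ballI impI)
    fix y assume y: "y \<in> S" "\<bar>y - y0\<bar> < min d 1"
    then have "dist (U y) (U y0) < \<bar>U y0\<bar>/2" using d(2)[of y] by (auto simp: dist_real_def)
    then have "\<bar>U y0\<bar>/2 \<le> \<bar>U y\<bar>" unfolding dist_real_def by linarith
    moreover have "\<bar>U y0\<bar>/2 * \<bar>y - y0\<bar> \<le> \<bar>U y0\<bar>/2 * 1" using y by (intro mult_left_mono) auto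
    ultimately show "\<bar>U y0\<bar>/2 * \<bar>y - y0\<bar> \<le> \<bar>U y\<bar>" by linarith
  qed
  moreover have "\<bar>U y0\<bar>/2 > 0" "min d 1 > 0" "min d 1 \<le> 1" using d False by auto
  ultimately show ?thesis by blast
next
  case True
  then have "D \<noteq> 0" using nz by simp
  then obtain d where d: "d > 0"
    "\<And>y. y \<in> S \<Longrightarrow> norm (y - y0) < d \<Longrightarrow> norm (U y - U y0 - D * (y - y0)) \<le> \<bar>D\<bar>/2 * norm (y - y0)"
    using assms(1) unfolding has_field_derivative_def has_derivative_within_alt
    by (metis half_gt_zero zero_less_abs_iff)
  have "\<forall>y\<in>S. \<bar>y - y0\<bar> < min d 1 \<longrightarrow> \<bar>D\<bar>/2 * \<bar>y - y0\<bar> \<le> \<bar>U y\<bar>"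
  proof (intro ballI impI)
    fix y assume y: "y \<in> S" "\<bar>y - y0\<bar> < min d 1"
    then have "\<bar>U y - D * (y - y0)\<bar> \<le> \<bar>D\<bar>/2 * \<bar>y - y0\<bar>" using d(2)[of y] True by simp
    moreover have "\<bar>D * (y - y0)\<bar> = \<bar>D\<bar> * \<bar>y - y0\<bar>" by (rule abs_mult)
    ultimately show "\<bar>D\<bar>/2 * \<bar>y - y0\<bar> \<le> \<bar>U y\<bar>" by linarith
  qed
  moreover have "\<bar>D\<bar>/2 > 0" "min d 1 > 0" "min d 1 \<le> 1" using d \<open>D \<noteq> 0\<close> by auto
  ultimately show ?thesis by blast
qed

lemma continuous_on_Icc_bounded:
  fixes f :: "real \<Rightarrow> 'a :: real_normed_vector"
  assumes "continuous_on {a..b} f"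
  obtains B where "B \<ge> 0" "\<And>y. y \<in> {a..b} \<Longrightarrow> norm (f y) \<le> B"
proof -
  obtain B where "\<forall>y\<in>{a..b}. norm (f y) \<le> B"
    using compact_imp_bounded[OF compact_continuous_image[OF assms compact_Icc]]
    by (auto simp: bounded_iff)
  then show thesis by (intro that[of "max B 0"]) (auto intro: max.coboundedI1)
qed

text \<open>The function \<open>G = h h' - U' h\<^sup>2 / (U - c)\<close> of Picone's identity vanishes at both ends and has
  derivative at least \<open>\<alpha>\<^sup>2 h\<^sup>2\<close>. At an end with \<open>U = c\<close> its value is right because \<open>0 / 0 = 0\<close>.\<close>
lemma singular_comparison:
  fixes U U1 U2 h g :: "real \<Rightarrow> real"
  assumes "p < q" "\<alpha> \<noteq> 0"
    and U: "\<And>y. y \<in> {p..q} \<Longrightarrow> (U has_real_derivative U1 y) (at y within {p..q})"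
    and U1: "\<And>y. y \<in> {p..q} \<Longrightarrow> (U1 has_real_derivative U2 y) (at y within {p..q})"
    and h: "\<And>y. y \<in> {p..q} \<Longrightarrow> (h has_real_derivative g y) (at y within {p..q})"
    and g: "continuous_on {p..q} g"
    and ends: "h p = 0" "h q = 0" "U p \<noteq> c \<or> U1 p \<noteq> 0" "U q \<noteq> c \<or> U1 q \<noteq> 0"
    and nz: "\<And>y. y \<in> {p<..<q} \<Longrightarrow> U y \<noteq> c"
    and sgn: "\<And>y. y \<in> {p<..<q} \<Longrightarrow> \<beta> * (U y - c) \<le> 0"
    and ode: "\<And>y. y \<in> {p<..<q} \<Longrightarrow>
      (g has_real_derivative (\<alpha>\<^sup>2 - (\<beta> - U2 y) / (U y - c)) * h y) (at y)"
    and y: "y \<in> {p..q}"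
  shows "h y = 0"
proof -
  define G where "G = (\<lambda>y. h y * g y - U1 y * (h y)\<^sup>2 / (U y - c))"
  have contU: "continuous_on {p..q} U" and contU1: "continuous_on {p..q} U1" and conth: "continuous_on {p..q} h"
    using U U1 h by (meson DERIV_continuous continuous_on_eq_continuous_within)+
  obtain B1 where B1: "B1 \<ge> 0" "\<And>y. y \<in> {p..q} \<Longrightarrow> \<bar>U1 y\<bar> \<le> B1"
    using continuous_on_Icc_bounded[OF contU1] by auto
  obtain Bg where Bg: "Bg \<ge> 0" "\<And>y. y \<in> {p..q} \<Longrightarrow> \<bar>g y\<bar> \<le> Bg"
    using continuous_on_Icc_bounded[OF g] by auto
  \<comment> \<open>\<open>h\<close> vanishes at such an end and is at most linear in the distance
    to it, while \<open>\<bar>U - c\<bar>\<close> is at least linear; so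
    \<open>h\<^sup>2 / (U - c)\<close> is at most linear and \<open>G\<close> tends to 0.\<close>
  have contG_end: "continuous (at e within {p..q}) G"
    if e: "e \<in> {p..q}" "h e = 0" "U e \<noteq> c \<or> U1 e \<noteq> 0" for e
  proof -
    have "((\<lambda>y. U y - c) has_real_derivative U1 e) (at e within {p..q})"
      by (auto intro!: derivative_eq_intros U e)
    moreover have "U e - c \<noteq> 0 \<or> U1 e \<noteq> 0" using e by auto
    ultimately have "\<exists>m>0. \<exists>\<delta>>0. \<delta> \<le> 1 \<and> (\<forall>y\<in>{p..q}. \<bar>y - e\<bar> < \<delta> \<longrightarrow> m * \<bar>y - e\<bar> \<le> \<bar>U y - c\<bar>)"
      by (rule abs_ge_linear_near)
    then obtain m \<delta> where m: "m > 0" "\<delta> > 0"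
      "\<And>y. y \<in> {p..q} \<Longrightarrow> \<bar>y - e\<bar> < \<delta> \<Longrightarrow> m * \<bar>y - e\<bar> \<le> \<bar>U y - c\<bar>"
      by blast
    have hb: "\<bar>h y\<bar> \<le> Bg * \<bar>y - e\<bar>" if y: "y \<in> {p..q}" for y
    proof -
      have J: "closed_segment e y \<subseteq> {p..q}" using y e by (simp add: closed_segment_subset)
      have "\<bar>h y - h e\<bar> \<le> Bg * \<bar>y - e\<bar>"
      proof (rule abs_diff_le_open_segment)
        show "continuous_on (closed_segment e y) h" using continuous_on_subset[OF conth J] .
        fix x assume "x \<in> open_segment e y"
        then have x: "x \<in> {p<..<q}" using y e
          by (auto simp: open_segment_eq_real_ivl split: if_splits)
        then show "(h has_real_derivative g x) (at x)"
          using h[of x] at_within_Icc_at[of p x q] by auto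
        show "\<bar>g x\<bar> \<le> Bg" using Bg(2) x by auto
      qed
      then show ?thesis using e by simp
    qed
    have bd: "\<bar>G y\<bar> \<le> (Bg * Bg + B1 * Bg\<^sup>2 / m) * \<bar>y - e\<bar>" if y: "y \<in> {p..q}" "\<bar>y - e\<bar> < \<delta>" for y
    proof (cases "y = e")
      case True then show ?thesis using e by (simp add: G_def)
    next
      case False
      have pos: "m * \<bar>y - e\<bar> > 0" using False m by simp
      have "(h y)\<^sup>2 / \<bar>U y - c\<bar> \<le> (Bg * \<bar>y - e\<bar>)\<^sup>2 / (m * \<bar>y - e\<bar>)"
        using hb[OF y(1)] m(3)[OF y] pos
        by (intro frac_le) (auto simp: abs_le_square_iff[symmetric])
      also have "\<dots> = Bg\<^sup>2 / m * \<bar>y - e\<bar>"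
      proof -
        have "(Bg * d)\<^sup>2 / (m * d) = Bg\<^sup>2 / m * d" if "d > 0" for d
          using that m(1) by (simp add: field_simps power2_eq_square)
        then show ?thesis using False by simp
      qed
      finally have 1: "(h y)\<^sup>2 / \<bar>U y - c\<bar> \<le> Bg\<^sup>2 / m * \<bar>y - e\<bar>" .
      have "\<bar>G y\<bar> \<le> \<bar>h y\<bar> * \<bar>g y\<bar> + \<bar>U1 y\<bar> * ((h y)\<^sup>2 / \<bar>U y - c\<bar>)"
        unfolding G_def by (rule order_trans[OF abs_triangle_ineq4]) (simp add: abs_mult)
      also have "\<dots> \<le> (Bg * \<bar>y - e\<bar>) * Bg + B1 * (Bg\<^sup>2 / m * \<bar>y - e\<bar>)"
        using 1 hb[OF y(1)] Bg(2)[OF y(1)] B1(2)[OF y(1)] Bg(1) B1(1) by (intro add_mono mult_mono) auto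
      finally show ?thesis by (simp add: algebra_simps)
    qed
    have "(G \<longlongrightarrow> 0) (at e within {p..q})"
    proof (rule tendsto_rabs_zero_cancel, rule tendsto_sandwich)
      show "eventually (\<lambda>y. 0 \<le> \<bar>G y\<bar>) (at e within {p..q})" by simp
      show "eventually (\<lambda>y. \<bar>G y\<bar> \<le> (Bg * Bg + B1 * Bg\<^sup>2 / m) * \<bar>y - e\<bar>) (at e within {p..q})"
        unfolding eventually_at using m(2) bd by (auto simp: dist_real_def)
      have "((\<lambda>y. (Bg * Bg + B1 * Bg\<^sup>2 / m) * \<bar>y - e\<bar>) \<longlongrightarrow> (Bg * Bg + B1 * Bg\<^sup>2 / m) * \<bar>e - e\<bar>) (at e within {p..q})"
        by (intro tendsto_intros)
      then show "((\<lambda>y. (Bg * Bg + B1 * Bg\<^sup>2 / m) * \<bar>y - e\<bar>) \<longlongrightarrow> 0) (at e within {p..q})" by simp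
    qed simp
    moreover have "G e = 0" using e by (simp add: G_def)
    ultimately show ?thesis by (simp add: continuous_within)
  qed
  \<comment> \<open>As \<open>U - c\<close> has second derivative \<open>U2\<close>, the terms with
    \<open>U2\<close> cancel and the rest completes a square; the sign of \<open>G'\<close> depends
    only on that of \<open>\<beta> / (U y - c)\<close>.\<close>
  define G' where "G' = (\<lambda>y. \<alpha>\<^sup>2 * (h y)\<^sup>2 + (g y - U1 y * h y / (U y - c))\<^sup>2 - \<beta> / (U y - c) * (h y)\<^sup>2)"
  have G': "(G has_real_derivative G' y) (at y)" if y: "y \<in> {p<..<q}" for y
  proof -
    have at: "at y within {p..q} = at y" using y at_within_Icc_at[of p y q] by auto
    have d: "(U has_real_derivative U1 y) (at y)" "(U1 has_real_derivative U2 y) (at y)"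
      "(h has_real_derivative g y) (at y)"
      using U[of y] U1[of y] h[of y] y unfolding at by auto
    let ?x = "U y - c"
    have "((\<lambda>y. (h y)\<^sup>2) has_real_derivative 2 * h y * g y) (at y)"
      using DERIV_power[OF d(3), of 2] by (simp add: ac_simps)
    from DERIV_mult[OF d(2) this]
    have "((\<lambda>y. U1 y * (h y)\<^sup>2) has_real_derivative U2 y * (h y)\<^sup>2 + 2 * h y * g y * U1 y) (at y)" .
    moreover have "((\<lambda>y. U y - c) has_real_derivative U1 y) (at y)"
      using DERIV_diff[OF d(1) DERIV_const[of c]] by simp
    ultimately have "((\<lambda>y. U1 y * (h y)\<^sup>2 / (U y - c)) has_real_derivative
        ((U2 y * (h y)\<^sup>2 + 2 * h y * g y * U1 y) * ?x - U1 y * (h y)\<^sup>2 * U1 y) / (?x * ?x)) (at y)"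
      using nz[OF y] by (intro DERIV_divide) auto
    from DERIV_diff[OF DERIV_mult[OF d(3) ode[OF y]] this]
    have "(G has_real_derivative g y * g y + (\<alpha>\<^sup>2 - (\<beta> - U2 y) / ?x) * h y * h y
      - ((U2 y * (h y)\<^sup>2 + 2 * h y * g y * U1 y) * ?x - U1 y * (h y)\<^sup>2 * U1 y) / (?x * ?x)) (at y)"
      unfolding G_def .
    moreover have "gy * gy + (A - (\<beta> - u2) / x) * hy * hy - ((u2 * hy\<^sup>2 + 2 * hy * gy * u1) * x - u1 * hy\<^sup>2 * u1) / (x * x)
      = A * hy\<^sup>2 + (gy - u1 * hy / x)\<^sup>2 - \<beta> / x * hy\<^sup>2" if "x \<noteq> 0" for gy hy A u1 u2 x :: real
      using that by (simp add: field_simps power2_eq_square)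
    ultimately show ?thesis unfolding G'_def using nz[OF y] by simp
  qed
  have G'_ge: "G' y \<ge> \<alpha>\<^sup>2 * (h y)\<^sup>2" if y: "y \<in> {p<..<q}" for y
  proof -
    have "\<beta> / (U y - c) \<le> 0" using sgn[OF y] nz[OF y] by (auto simp: divide_le_0_iff mult_le_0_iff)
    then have "\<beta> / (U y - c) * (h y)\<^sup>2 \<le> 0" by (rule mult_nonpos_nonneg) simp
    moreover have "(g y - U1 y * h y / (U y - c))\<^sup>2 \<ge> 0" by simp
    ultimately show ?thesis unfolding G'_def by linarith
  qed
  have G'_nonneg: "G' y \<ge> 0" if "y \<in> {p<..<q}" for y
    using G'_ge[OF that] by (meson order_trans zero_le_mult_iff zero_le_power2)
  have contG: "continuous_on {p..q} G"
    unfolding continuous_on_eq_continuous_within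
  proof
    fix x assume x: "x \<in> {p..q}"
    show "continuous (at x within {p..q}) G"
    proof (cases "x = p \<or> x = q")
      case True then show ?thesis using contG_end ends x by blast
    next
      case False
      then have "x \<in> {p<..<q}" using x by auto
      then show ?thesis using G' by (meson DERIV_isCont continuous_at_imp_continuous_at_within)
    qed
  qed
  \<comment> \<open>\<open>G\<close> is nondecreasing and 0 at both ends, hence identically 0; so
    \<open>G'\<close> vanishes inside, and with it
    \<open>\<alpha>\<^sup>2 * (h y)\<^sup>2\<close>.\<close>
  have mono: "G s \<le> G t" if "p \<le> s" "s \<le> t" "t \<le> q" for s t
  proof (rule DERIV_nonneg_imp_increasing_open[OF that(2)])
    show "\<exists>D. (G has_real_derivative D) (at x) \<and> 0 \<le> D" if "s < x" "x < t" for x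
      using G'[of x] G'_nonneg[of x] \<open>p \<le> s\<close> \<open>t \<le> q\<close> that by auto
    show "continuous_on {s..t} G" by (rule continuous_on_subset[OF contG]) (use that in auto)
  qed
  have G0: "G y = 0" if "y \<in> {p..q}" for y
    using mono[of p y] mono[of y q] that ends by (auto simp: G_def)
  show ?thesis
  proof (cases "y = p \<or> y = q")
    case True then show ?thesis using ends by auto
  next
    case False
    then have yi: "y \<in> {p<..<q}" using y by auto
    have "(G has_real_derivative 0) (at y)"
      by (rule has_field_derivative_transform_within_open[of "\<lambda>_. 0" _ _ "{p<..<q}"]) (use yi G0 in auto)
    then have "G' y = 0" using G'[OF yi] DERIV_unique by blast
    then show ?thesis using G'_ge[OF yi] \<open>\<alpha> \<noteq> 0\<close> by (auto simp: mult_le_0_iff)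
  qed
qed

section \<open>Vanishing on the whole interval by unique continuation\<close>

text \<open>Vanishing is first obtained on one interval between neighbouring roots or ends, by
  \<open>singular_comparison\<close>. It then spreads: the points where \<open>h\<close> and
  \<open>g\<close> both vanish form a closed set, which is open by
  \<open>singular_ode_local_uniqueness\<close>, and \<open>{a..b}\<close> is connected.\<close>

lemma singular_dirichlet_solution_zero:
  fixes U U1 U2 h g :: "real \<Rightarrow> real"
  assumes "a < b" "\<alpha> \<noteq> 0"
    and U: "\<And>y. y \<in> {a..b} \<Longrightarrow> (U has_real_derivative U1 y) (at y within {a..b})"
    and U1: "\<And>y. y \<in> {a..b} \<Longrightarrow> (U1 has_real_derivative U2 y) (at y within {a..b})"
    and U2: "continuous_on {a..b} U2"
    and regular: "\<And>y. y \<in> {a..b} \<Longrightarrow> U y = c \<Longrightarrow> U1 y \<noteq> 0"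
    and root: "z \<in> {a<..<b}" "U z = c"
    and h: "\<And>y. y \<in> {a..b} \<Longrightarrow> (h has_real_derivative g y) (at y within {a..b})"
    and g: "continuous_on {a..b} g"
    and ends: "h a = 0" "h b = 0" "\<And>y. y \<in> {a..b} \<Longrightarrow> U y = c \<Longrightarrow> h y = 0"
    and ode: "\<And>y. y \<in> {a<..<b} \<Longrightarrow> U y \<noteq> c \<Longrightarrow>
      (g has_real_derivative (\<alpha>\<^sup>2 - (\<beta> - U2 y) / (U y - c)) * h y) (at y)"
    and y: "y \<in> {a..b}"
  shows "h y = 0"
proof -
  have contU: "continuous_on {a..b} U"
    using U by (meson DERIV_continuous continuous_on_eq_continuous_within)
  have contU': "continuous_on {a..b} (\<lambda>y. U y - c)"
    by (intro continuous_intros contU)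
  \<comment> \<open>A simple interior root makes \<open>U - c\<close> change sign, so points of
    either sign exist; the one that suits the sign of \<open>\<beta>\<close> is taken.\<close>
  obtain w where w: "w \<in> {a<..<b}" "U w \<noteq> c" "\<beta> * (U w - c) \<le> 0"
  proof -
    have at: "at z within {a..b} = at z" using root at_within_Icc_at[of a z b] by auto
    have D: "(U has_real_derivative U1 z) (at z)" "U1 z \<noteq> 0"
      using U[of z] root regular[of z] unfolding at by auto
    have "\<exists>d>0. \<forall>t. 0 < t \<and> t < d \<longrightarrow>
      (if U1 z > 0 then U (z - t) < U z \<and> U z < U (z + t) else U (z + t) < U z \<and> U z < U (z - t))"
    proof (cases "U1 z > 0")
      case True
      obtain d1 d2 where "d1 > 0" "d2 > 0"
        "\<forall>t>0. t < d1 \<longrightarrow> U (z - t) < U z" "\<forall>t>0. t < d2 \<longrightarrow> U z < U (z + t)"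
        using DERIV_pos_inc_left[OF D(1) True] DERIV_pos_inc_right[OF D(1) True] by blast
      then show ?thesis using True by (intro exI[of _ "min d1 d2"]) auto
    next
      case False
      then have neg: "U1 z < 0" using D by simp
      obtain d1 d2 where "d1 > 0" "d2 > 0"
        "\<forall>t>0. t < d1 \<longrightarrow> U z < U (z - t)" "\<forall>t>0. t < d2 \<longrightarrow> U (z + t) < U z"
        using DERIV_neg_dec_left[OF D(1) neg] DERIV_neg_dec_right[OF D(1) neg] by blast
      then show ?thesis using False by (intro exI[of _ "min d1 d2"]) auto
    qed
    then obtain d where d: "d > 0" "\<And>t. 0 < t \<Longrightarrow> t < d \<Longrightarrow>
      (if U1 z > 0 then U (z - t) < U z \<and> U z < U (z + t) else U (z + t) < U z \<and> U z < U (z - t))"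
      by blast
    define t where "t = min d (min (z - a) (b - z)) / 2"
    have t: "0 < t" "t < d" "z - t \<in> {a<..<b}" "z + t \<in> {a<..<b}"
      using d(1) root by (auto simp: t_def min_def field_simps)
    have "U (z - t) < c \<and> c < U (z + t) \<or> U (z + t) < c \<and> c < U (z - t)"
      using d(2)[OF t(1,2)] root by (auto split: if_splits)
    then have "\<exists>s\<in>{z - t, z + t}. U s < c" "\<exists>s\<in>{z - t, z + t}. U s > c" by auto
    then obtain s1 s2 where "s1 \<in> {a<..<b}" "U s1 < c" "s2 \<in> {a<..<b}" "U s2 > c"
      using t by blast
    then show thesis
      using that[of s1] that[of s2] by (cases "\<beta> \<ge> 0") (auto simp: mult_le_0_iff)
  qed
  \<comment> \<open>The ends are counted among the roots so that \<open>w\<close> has members of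
    \<open>R\<close> on both sides; \<open>p\<close> and \<open>q\<close> will be the nearest
    ones.\<close>
  define R where "R = {a, b} \<union> {y\<in>{a..b}. U y = c}"
  have "closed {y\<in>{a..b}. U y = c}"
    using continuous_closed_preimage_constant[OF contU] by simp
  then have "closed R" unfolding R_def by auto
  have R: "R \<subseteq> {a..b}" using \<open>a < b\<close> by (auto simp: R_def)
  have "compact (R \<inter> {a..w})" "compact (R \<inter> {w..b})"
    by (auto intro: closed_Int_compact \<open>closed R\<close>)
  moreover have "R \<inter> {a..w} \<noteq> {}" "R \<inter> {w..b} \<noteq> {}" using w by (auto simp: R_def)
  ultimately obtain p q where p: "p \<in> R \<inter> {a..w}" "\<And>x. x \<in> R \<inter> {a..w} \<Longrightarrow> x \<le> p"
    and q: "q \<in> R \<inter> {w..b}" "\<And>x. x \<in> R \<inter> {w..b} \<Longrightarrow> q \<le> x"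
    using compact_attains_sup[of "R \<inter> {a..w}"] compact_attains_inf[of "R \<inter> {w..b}"] by metis
  have "w \<notin> R" using w by (auto simp: R_def)
  then have pq: "p < w" "w < q" using p q by (auto simp: less_le)
  have sub: "{p..q} \<subseteq> {a..b}" using p q by auto
  have nz: "U x \<noteq> c" if "x \<in> {p<..<q}" for x
  proof
    assume "U x = c"
    then have "x \<in> R" using that sub by (auto simp: R_def)
    then show False using p(2)[of x] q(2)[of x] that sub by (cases "x \<le> w") auto
  qed
  have sgn: "\<beta> * (U x - c) \<le> 0" if x: "x \<in> {p<..<q}" for x
  proof (rule ccontr)
    assume "\<not> \<beta> * (U x - c) \<le> 0"
    \<comment> \<open>A wrong sign at \<open>x\<close> would put 0 between \<open>U x - c\<close>
      and \<open>U w - c\<close>, hence a root between \<open>x\<close> and \<open>w\<close>, inside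
      a root-free interval.\<close>
    then have "(U x - c) * (U w - c) \<le> 0" using w by (auto simp: mult_le_0_iff not_le zero_less_mult_iff)
    then have sgn: "U x - c \<le> 0 \<and> 0 \<le> U w - c \<or> U w - c \<le> 0 \<and> 0 \<le> U x - c"
      by (auto simp: mult_le_0_iff)
    have sg: "closed_segment x w \<subseteq> {p<..<q}"
      using x pq by (intro closed_segment_subset) auto
    have "connected ((\<lambda>y. U y - c) ` closed_segment x w)"
      using sg sub by (intro connected_continuous_image continuous_on_subset[OF contU']) fastforce+
    then have "0 \<in> (\<lambda>y. U y - c) ` closed_segment x w"
      using sgn connectedD_interval[of "(\<lambda>y. U y - c) ` closed_segment x w" "U x - c" "U w - c" 0]
        connectedD_interval[of "(\<lambda>y. U y - c) ` closed_segment x w" "U w - c" "U x - c" 0] by blast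
    then show False using nz sg by auto
  qed
  have "h x = 0" if x: "x \<in> {p..q}" for x
  proof (rule singular_comparison[where h=h and g=g and U=U and ?U1.0=U1 and ?U2.0=U2 and c=c and \<beta>=\<beta> and \<alpha>=\<alpha> and p=p and q=q])
    show "p < q" using pq by simp
    show "(U has_real_derivative U1 y) (at y within {p..q})"
      "(U1 has_real_derivative U2 y) (at y within {p..q})"
      "(h has_real_derivative g y) (at y within {p..q})" if "y \<in> {p..q}" for y
      using U[of y] U1[of y] h[of y] that sub by (auto intro: DERIV_subset)
    show "continuous_on {p..q} g" using continuous_on_subset[OF g sub] .
    show "h p = 0" "h q = 0" using p q ends by (auto simp: R_def)
    show "U p \<noteq> c \<or> U1 p \<noteq> 0" "U q \<noteq> c \<or> U1 q \<noteq> 0" using p q regular R by auto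
    show "(g has_real_derivative (\<alpha>\<^sup>2 - (\<beta> - U2 y) / (U y - c)) * h y) (at y)" if "y \<in> {p<..<q}" for y
      using ode[of y] nz[OF that] that sub p q by auto
  qed (use assms nz sgn x in auto)
  define Z where "Z = {y\<in>{a..b}. h y = 0 \<and> g y = 0}"
  have "g w = 0"
  proof -
    have "(h has_real_derivative 0) (at w)"
      by (rule has_field_derivative_transform_within_open[of "\<lambda>_. 0" _ _ "{p<..<q}"])
        (use pq \<open>\<And>x. x \<in> {p..q} \<Longrightarrow> h x = 0\<close> in auto)
    moreover have "(h has_real_derivative g w) (at w)"
      using h[of w] w at_within_Icc_at[of a w b] by auto
    ultimately show ?thesis using DERIV_unique by blast
  qed
  then have "w \<in> Z" using w pq \<open>\<And>x. x \<in> {p..q} \<Longrightarrow> h x = 0\<close> by (auto simp: Z_def)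
  have conth: "continuous_on {a..b} h"
    using h by (meson DERIV_continuous continuous_on_eq_continuous_within)
  obtain B2 where B2: "B2 \<ge> 0" "\<And>y. y \<in> {a..b} \<Longrightarrow> \<bar>\<beta> - U2 y\<bar> \<le> B2"
    using continuous_on_Icc_bounded[of a b "\<lambda>y. \<beta> - U2 y"] U2
    by (auto simp: continuous_on_diff)
  have op: "\<exists>\<epsilon>>0. \<forall>y\<in>{a..b}. \<bar>y - y0\<bar> < \<epsilon> \<longrightarrow> h y = 0 \<and> g y = 0" if "y0 \<in> Z" for y0
  proof -
    have y0: "y0 \<in> {a..b}" "h y0 = 0" "g y0 = 0" using that by (auto simp: Z_def)
    have "((\<lambda>y. U y - c) has_real_derivative U1 y0) (at y0 within {a..b})"
      by (auto intro!: derivative_eq_intros U y0)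
    moreover have "U y0 - c \<noteq> 0 \<or> U1 y0 \<noteq> 0" using regular y0 by auto
    ultimately have "\<exists>m>0. \<exists>\<delta>>0. \<delta> \<le> 1 \<and> (\<forall>y\<in>{a..b}. \<bar>y - y0\<bar> < \<delta> \<longrightarrow> m * \<bar>y - y0\<bar> \<le> \<bar>U y - c\<bar>)"
      by (rule abs_ge_linear_near)
    then obtain m \<delta> where m: "m > 0" "\<delta> > 0" "\<delta> \<le> 1"
      "\<And>y. y \<in> {a..b} \<Longrightarrow> \<bar>y - y0\<bar> < \<delta> \<Longrightarrow> m * \<bar>y - y0\<bar> \<le> \<bar>U y - c\<bar>"
      by blast
    have nz0: "U y \<noteq> c" if "y \<in> {a<..<b}" "y \<noteq> y0" "\<bar>y - y0\<bar> < \<delta>" for y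
      using m(4)[of y] that m(1) by (auto simp: mult_le_0_iff)
    show ?thesis
    proof (rule singular_ode_local_uniqueness[OF h g y0 m(2), where C = "\<alpha>\<^sup>2 + B2 / m"
          and ?g2.0 = "\<lambda>y. (\<alpha>\<^sup>2 - (\<beta> - U2 y) / (U y - c)) * h y"])
      fix y assume y: "y \<in> {a<..<b}" "y \<noteq> y0" "\<bar>y - y0\<bar> < \<delta>"
      show "(g has_real_derivative (\<alpha>\<^sup>2 - (\<beta> - U2 y) / (U y - c)) * h y) (at y)"
        using ode nz0 y by blast
      have pos: "\<bar>y - y0\<bar> > 0" using y by simp
      have "\<bar>\<alpha>\<^sup>2 - (\<beta> - U2 y) / (U y - c)\<bar> \<le> \<alpha>\<^sup>2 + \<bar>\<beta> - U2 y\<bar> / \<bar>U y - c\<bar>"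
        by (rule order_trans[OF abs_triangle_ineq4]) simp
      also have "\<bar>\<beta> - U2 y\<bar> / \<bar>U y - c\<bar> \<le> B2 / (m * \<bar>y - y0\<bar>)"
        using B2 m(4)[of y] y m(1) pos by (intro frac_le) auto
      \<comment> \<open>Here \<open>\<delta> \<le> 1\<close> enters: the bounded term fits under the
        singular bound because \<open>\<bar>y - y0\<bar> < 1\<close>.\<close>
      also have "\<alpha>\<^sup>2 \<le> \<alpha>\<^sup>2 / \<bar>y - y0\<bar>"
        using pos y m(3) frac_le[of "\<alpha>\<^sup>2" "\<alpha>\<^sup>2" "\<bar>y - y0\<bar>" 1] by simp
      finally have "\<bar>\<alpha>\<^sup>2 - (\<beta> - U2 y) / (U y - c)\<bar> \<le> (\<alpha>\<^sup>2 + B2 / m) / \<bar>y - y0\<bar>"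
        by (simp add: add_divide_distrib)
      then show "\<bar>(\<alpha>\<^sup>2 - (\<beta> - U2 y) / (U y - c)) * h y\<bar> \<le> (\<alpha>\<^sup>2 + B2 / m) / \<bar>y - y0\<bar> * \<bar>h y\<bar>"
        unfolding abs_mult by (rule mult_right_mono) simp
    qed
  qed
  have "openin (top_of_set {a..b}) Z"
    unfolding openin_contains_ball
  proof (intro conjI ballI)
    show "Z \<subseteq> {a..b}" by (auto simp: Z_def)
    fix x assume "x \<in> Z"
    then obtain \<epsilon> where "\<epsilon> > 0" "\<forall>y\<in>{a..b}. \<bar>y - x\<bar> < \<epsilon> \<longrightarrow> h y = 0 \<and> g y = 0" using op by blast
    then show "\<exists>e>0. ball x e \<inter> {a..b} \<subseteq> Z"
      by (intro exI[of _ \<epsilon>]) (auto simp: Z_def dist_real_def abs_minus_commute)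
  qed
  moreover have "closedin (top_of_set {a..b}) Z"
  proof -
    have "Z = {y\<in>{a..b}. h y = 0} \<inter> {y\<in>{a..b}. g y = 0}" by (auto simp: Z_def)
    then show ?thesis
      by (simp only:) (intro closedin_Int continuous_closedin_preimage_constant conth g)
  qed
  ultimately have "Z = {a..b}"
    using \<open>w \<in> Z\<close> connected_clopen[of "{a..b}"] by auto
  then have "y \<in> Z" using y by simp
  then show ?thesis by (simp add: Z_def)
qed

section \<open>A priori bounds for unstable modes\<close>

text \<open>The quotient \<open>(\<beta> - U'') / (U - u)\<close> is unconstrained where \<open>U = u\<close>. Boundedness forces
  \<open>U'' = \<beta>\<close> at limits of points with \<open>U \<noteq> u\<close>; inside a flat piece \<open>U'' = 0\<close>, and an end of that
  piece then gives \<open>\<beta> = 0\<close>.\<close>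
lemma U2_eq_beta_at_U_eq_u:
  fixes U U1 U2 :: "real \<Rightarrow> real"
  assumes U: "\<And>y. y \<in> {a..b} \<Longrightarrow> (U has_real_derivative U1 y) (at y within {a..b})"
    and U1: "\<And>y. y \<in> {a..b} \<Longrightarrow> (U1 has_real_derivative U2 y) (at y within {a..b})"
    and U2: "continuous_on {a..b} U2"
    and nc: "\<exists>x\<in>{a..b}. U x \<noteq> u"
    and bd: "\<And>y. y \<in> {a..b} \<Longrightarrow> U y \<noteq> u \<Longrightarrow> \<bar>\<beta> - U2 y\<bar> \<le> M * \<bar>U y - u\<bar>"
    and y: "y \<in> {a..b}" "U y = u"
  shows "U2 y = \<beta>"
proof -
  define S where "S = {y\<in>{a..b}. U y \<noteq> u}"
  have cS: "closure S \<subseteq> {a..b}" by (rule closure_minimal) (auto simp: S_def)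
  have contU: "continuous_on {a..b} U"
    using U by (meson DERIV_continuous continuous_on_eq_continuous_within)
  have lim: "U2 x = \<beta>" if x: "x \<in> closure S" "U x = u" for x
  proof -
    have "\<bar>\<beta> - U2 x\<bar> - M * \<bar>U x - u\<bar> \<le> 0"
      by (rule continuous_le_on_closure[where S=S and f="\<lambda>x. \<bar>\<beta> - U2 x\<bar> - M * \<bar>U x - u\<bar>", OF _ x(1)])
         (use bd cS in \<open>auto simp: S_def intro!: continuous_intros continuous_on_subset[OF U2] continuous_on_subset[OF contU]\<close>)
    then show ?thesis using x by simp
  qed
  show ?thesis
  proof (cases "y \<in> closure S")
    case True then show ?thesis using lim y by blast
  next
    case False
    have "closure S \<noteq> {}" using nc by (auto simp: S_def)
    \<comment> \<open>\<open>e\<close> is a point of \<open>closure S\<close> nearest to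
      \<open>y\<close>, so the open segment between them misses \<open>S\<close> and
      \<open>U = u\<close> on it.\<close>
    then obtain e where e: "e \<in> closure S" "\<And>x. x \<in> closure S \<Longrightarrow> dist y e \<le> dist y x"
      using distance_attains_inf[of "closure S" y] by auto
    have ne: "e \<noteq> y" using e False by auto
    let ?I = "open_segment y e"
    have clI: "closure ?I = closed_segment y e" using ne by (simp add: closure_open_segment)
    have sub: "closed_segment y e \<subseteq> {a..b}"
      using y e cS by (intro closed_segment_subset) auto
    have int: "?I \<subseteq> {a<..<b}" "open ?I"
      using sub y e cS by (auto simp: open_segment_eq_real_ivl split: if_splits)
    have Iu: "U x = u" if "x \<in> ?I" for x
    proof (rule ccontr)
      assume "U x \<noteq> u"
      then have "x \<in> closure S" using int that closure_subset[of S] by (force simp: S_def)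
      then have "dist y e \<le> dist y x" by (rule e)
      then show False using that by (auto simp: open_segment_eq_real_ivl dist_real_def split: if_splits)
    qed
    have at: "at x within {a..b} = at x" if "x \<in> ?I" for x
      using int that at_within_Icc_at[of a x b] by auto
    have I1: "U1 x = 0" if x: "x \<in> ?I" for x
    proof -
      have "(U has_real_derivative 0) (at x)"
        by (rule has_field_derivative_transform_within_open[of "\<lambda>_. u" _ _ ?I]) (use x Iu int in auto)
      then show ?thesis using U[of x] int x DERIV_unique unfolding at[OF x] by fastforce
    qed
    have I2: "U2 x = 0" if x: "x \<in> ?I" for x
    proof -
      have "(U1 has_real_derivative 0) (at x)"
        by (rule has_field_derivative_transform_within_open[of "\<lambda>_. 0" _ _ ?I]) (use x I1 int in auto)
      then show ?thesis using U1[of x] int x DERIV_unique unfolding at[OF x] by fastforce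
    qed
    \<comment> \<open>By continuity \<open>U2\<close> is 0 at both ends of the flat segment, whereas
      \<open>lim\<close> gives \<open>U2 e = \<beta>\<close>; hence
      \<open>\<beta> = 0 = U2 y\<close>.\<close>
    have "U2 x = 0" "U x = u" if "x \<in> closed_segment y e" for x
      using continuous_constant_on_closure[of ?I U2 0 x] continuous_constant_on_closure[of ?I U u x]
        continuous_on_subset[OF U2 sub] continuous_on_subset[OF contU sub] I2 Iu that unfolding clI by auto
    then show ?thesis using lim[OF e(1)] by auto
  qed
qed

text \<open>Where \<open>U y \<noteq> u\<close>, put \<open>\<beta> - U2 y = k * (U y - u)\<close>
  with \<open>0 < k \<le> M\<close>; the left side is then
  \<open>k * (U y - r)\<^sup>2 - k * (u - r)\<^sup>2\<close>. In the first term \<open>k\<close> is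
  at most \<open>M\<close>, in the second it dominates
  \<open>\<kappa> * (\<beta> - U2 y)\<^sup>2\<close>. The constants are uniform in \<open>r\<close>,
  which will be the real part of a moving \<open>c\<close>.\<close>

lemma K_beta_quadratic_bound:
  fixes U U1 U2 :: "real \<Rightarrow> real"
  assumes U: "\<And>y. y \<in> {a..b} \<Longrightarrow> (U has_real_derivative U1 y) (at y within {a..b})"
    and U1: "\<And>y. y \<in> {a..b} \<Longrightarrow> (U1 has_real_derivative U2 y) (at y within {a..b})"
    and U2: "continuous_on {a..b} U2"
    and nc: "\<exists>x\<in>{a..b}. U x \<noteq> u"
    and K: "K_beta_pos_bdd a b U U2 \<beta> u"
  shows "\<exists>M>0. \<exists>\<kappa>>0. \<forall>y\<in>{a..b}. \<forall>r.
    (\<beta> - U2 y) * (U y - 2 * r + u) \<le> M * (U y - r)\<^sup>2 - \<kappa> * (u - r)\<^sup>2 * (\<beta> - U2 y)\<^sup>2"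
proof -
  obtain M0 where M0: "\<forall>y\<in>{a..b}. U y \<noteq> u \<longrightarrow> \<bar>(\<beta> - U2 y) / (U y - u)\<bar> \<le> M0"
    using K by (auto simp: K_beta_pos_bdd_def)
  define M where "M = max M0 1"
  have M: "M > 0" "\<And>y. y \<in> {a..b} \<Longrightarrow> U y \<noteq> u \<Longrightarrow> \<bar>(\<beta> - U2 y) / (U y - u)\<bar> \<le> M"
    using M0 by (auto simp: M_def intro: max.coboundedI1)
  have contU: "continuous_on {a..b} U"
    using U by (meson DERIV_continuous continuous_on_eq_continuous_within)
  obtain R0 where R0: "R0 \<ge> 0" "\<And>y. y \<in> {a..b} \<Longrightarrow> \<bar>U y - u\<bar> \<le> R0"
    using continuous_on_Icc_bounded[of a b "\<lambda>y. U y - u"] contU by (auto simp: continuous_on_diff)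
  define R where "R = R0\<^sup>2 + 1"
  have R: "R > 0" "\<And>y. y \<in> {a..b} \<Longrightarrow> (U y - u)\<^sup>2 \<le> R"
    using R0 unfolding R_def
    by (auto simp: add_nonneg_pos) (metis abs_ge_zero abs_le_square_iff abs_of_nonneg add_increasing2 zero_le_one)
  \<comment> \<open>Chosen so that \<open>(\<beta> - U2 y)\<^sup>2 = k\<^sup>2 * (U y - u)\<^sup>2
    \<le> M * k * R\<close> reads
    \<open>\<kappa> * (\<beta> - U2 y)\<^sup>2 \<le> k\<close>.\<close>
  define \<kappa> where "\<kappa> = 1 / (M * R)"
  have \<kappa>: "\<kappa> > 0" using M R by (simp add: \<kappa>_def)
  have "(\<beta> - U2 y) * (U y - 2 * r + u) \<le> M * (U y - r)\<^sup>2 - \<kappa> * (u - r)\<^sup>2 * (\<beta> - U2 y)\<^sup>2"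
    if y: "y \<in> {a..b}" for y r
  proof (cases "U y = u")
    case True
    have "U2 y = \<beta>"
      by (rule U2_eq_beta_at_U_eq_u[OF U U1 U2 nc _ y True, where M=M])
         (use M(2) in \<open>auto simp: abs_divide divide_le_eq split: if_splits\<close>)
    then show ?thesis using M by simp
  next
    case False
    define k where "k = (\<beta> - U2 y) / (U y - u)"
    have k: "0 < k" using K y False unfolding K_beta_pos_bdd_def k_def by blast
    then have "k \<le> M" using M(2)[OF y False] by (simp only: k_def abs_of_pos)
    note k = k this
    have W: "\<beta> - U2 y = k * (U y - u)" using False by (simp add: k_def)
    have "k\<^sup>2 * (U y - u)\<^sup>2 \<le> (M * k) * R"
      using k R(2)[OF y] by (intro mult_mono) (auto simp: power2_eq_square)
    then have "\<kappa> * (\<beta> - U2 y)\<^sup>2 \<le> k"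
      unfolding W power_mult_distrib \<kappa>_def using M(1) R(1) by (simp add: divide_le_eq mult.assoc mult.commute mult.left_commute)
    then have "\<kappa> * (\<beta> - U2 y)\<^sup>2 * (u - r)\<^sup>2 \<le> k * (u - r)\<^sup>2" by (rule mult_right_mono) simp
    moreover have "(\<beta> - U2 y) * (U y - 2 * r + u) = k * (U y - r)\<^sup>2 - k * (u - r)\<^sup>2"
      unfolding W by (simp add: power2_eq_square algebra_simps)
    moreover have "k * (U y - r)\<^sup>2 \<le> M * (U y - r)\<^sup>2" using k by (intro mult_right_mono) auto
    ultimately show ?thesis by (simp add: algebra_simps)
  qed
  then show ?thesis using M(1) \<kappa> by blast
qed

section \<open>Regularity up to the ends and the energy estimate\<close>

text \<open>A mode is differentiable only inside the interval by definition. As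
  \<open>Im c > 0\<close> keeps the coefficient continuous up to the ends, integrating the equation
  twice from \<open>a\<close> recovers the mode up to constants inside, and continuity of
  \<open>\<phi>\<close> extends this to the ends. The fundamental theorem of calculus then applies
  on all of \<open>{a..b}\<close>.\<close>

lemma unstable_mode_C2_Icc:
  assumes um: "unstable_mode a b U U2 c \<alpha> \<beta> \<phi>" and "a < b"
    and U: "continuous_on {a..b} U" and U2: "continuous_on {a..b} U2"
  obtains \<phi>1 where "\<And>y. y \<in> {a..b} \<Longrightarrow> (\<phi> has_vector_derivative \<phi>1 y) (at y within {a..b})"
    "\<And>y. y \<in> {a..b} \<Longrightarrow> (\<phi>1 has_vector_derivative
       (complex_of_real (\<alpha>\<^sup>2) - complex_of_real (\<beta> - U2 y) / (complex_of_real (U y) - c)) * \<phi> y)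
       (at y within {a..b})"
proof -
  let ?w = "\<lambda>y. (complex_of_real (\<alpha>\<^sup>2) - complex_of_real (\<beta> - U2 y) / (complex_of_real (U y) - c)) * \<phi> y"
  have contphi: "continuous_on {a..b} \<phi>" and "Im c > 0" using um by (auto simp: unstable_mode_def)
  obtain f1 f2 where f: "\<And>y. y \<in> {a<..<b} \<Longrightarrow> (\<phi> has_vector_derivative f1 y) (at y)"
    "\<And>y. y \<in> {a<..<b} \<Longrightarrow> (f1 has_vector_derivative f2 y) (at y)"
    "\<And>y. y \<in> {a<..<b} \<Longrightarrow> - f2 y + complex_of_real (\<alpha>\<^sup>2) * \<phi> y
          - complex_of_real (\<beta> - U2 y) / (complex_of_real (U y) - c) * \<phi> y = 0"
    using um unfolding unstable_mode_def by blast
  have nz: "complex_of_real (U y) - c \<noteq> 0" for y using \<open>Im c > 0\<close> by (auto simp: complex_eq_iff)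
  have contw: "continuous_on {a..b} ?w"
    by (intro continuous_intros contphi U U2) (use nz in auto)
  have f2: "f2 y = ?w y" if "y \<in> {a<..<b}" for y
    using f(3)[OF that] by (simp add: algebra_simps)
  define P where "P = (\<lambda>y. integral {a..y} ?w)"
  have P: "(P has_vector_derivative ?w y) (at y within {a..b})" if "y \<in> {a..b}" for y
    unfolding P_def by (rule integral_has_vector_derivative[OF contw that])
  have at: "at y within {a..b} = at y" if "y \<in> {a<..<b}" for y
    using that at_within_Icc_at[of a y b] by auto
  have dP: "((\<lambda>y. f1 y - P y) has_vector_derivative 0) (at y within {a<..<b})" if "y \<in> {a<..<b}" for y
  proof -
    have "y \<in> {a..b}" using that by simp
    then have "(P has_vector_derivative f2 y) (at y)"
      using P unfolding at[OF that, symmetric] f2[OF that] by blast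
    from has_vector_derivative_diff[OF f(2)[OF that] this]
    show ?thesis by (simp add: has_vector_derivative_at_within)
  qed
  have "\<exists>C. \<forall>y\<in>{a<..<b}. f1 y - P y = C"
    by (rule has_vector_derivative_zero_constant[OF convex_real_interval(8) dP]) (assumption, blast)
  then obtain C where C: "\<And>y. y \<in> {a<..<b} \<Longrightarrow> f1 y - P y = C" by blast
  \<comment> \<open>\<open>g\<close> extends the interior derivative \<open>f1\<close> continuously
    to the closed interval.\<close>
  define g where "g = (\<lambda>y. P y + C)"
  have g: "(g has_vector_derivative ?w y) (at y within {a..b})" if "y \<in> {a..b}" for y
    unfolding g_def has_vector_derivative_add_const by (rule P[OF that])
  have contg: "continuous_on {a..b} g"
    by (rule continuous_on_vector_derivative[where f'="?w"]) (rule g)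
  define Q where "Q = (\<lambda>y. integral {a..y} g)"
  have Q: "(Q has_vector_derivative g y) (at y within {a..b})" if "y \<in> {a..b}" for y
    unfolding Q_def by (rule integral_has_vector_derivative[OF contg that])
  have dQ: "((\<lambda>y. \<phi> y - Q y) has_vector_derivative 0) (at y within {a<..<b})" if "y \<in> {a<..<b}" for y
  proof -
    have "f1 y = g y" using C[OF that] by (simp add: g_def algebra_simps)
    then have "(Q has_vector_derivative f1 y) (at y)"
      using Q[of y] that unfolding at[OF that] by auto
    from has_vector_derivative_diff[OF f(1)[OF that] this]
    show ?thesis by (simp add: has_vector_derivative_at_within)
  qed
  have "\<exists>D. \<forall>y\<in>{a<..<b}. \<phi> y - Q y = D"
    by (rule has_vector_derivative_zero_constant[OF convex_real_interval(8) dQ]) (assumption, blast)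
  then obtain D where D: "\<And>y. y \<in> {a<..<b} \<Longrightarrow> \<phi> y - Q y = D" by blast
  have contQ: "continuous_on {a..b} Q"
    by (rule continuous_on_vector_derivative[where f'=g]) (rule Q)
  have cl: "closure {a<..<b} = {a..b}" using \<open>a < b\<close> by simp
  have phi: "\<phi> y = Q y + D" if "y \<in> {a..b}" for y
    using continuous_constant_on_closure[of "{a<..<b}" "\<lambda>y. \<phi> y - Q y" D y] D that contphi contQ
    unfolding cl by (auto simp: continuous_on_diff algebra_simps)
  have "(\<phi> has_vector_derivative g y) (at y within {a..b})" if y: "y \<in> {a..b}" for y
  proof -
    have "((\<lambda>y. Q y + D) has_vector_derivative g y) (at y within {a..b})"
      unfolding has_vector_derivative_add_const by (rule Q[OF y])
    then show ?thesis by (rule has_vector_derivative_transform[OF y, rotated]) (use phi in auto)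
  qed
  then show thesis using that g by blast
qed

text \<open>The flux \<open>F\<close> vanishes at both ends, so \<open>F'\<close> has integral 0.
  Pointwise \<open>f \<le> F'\<close>, by \<open>quad\<close> and after discarding nonnegative
  terms, and the integral of \<open>f\<close> is the difference of the two sides.\<close>

lemma unstable_mode_weighted_L2_bound:
  assumes "a < b" "Im c > 0"
    and U: "continuous_on {a..b} U" and U2: "continuous_on {a..b} U2"
    and d1: "\<And>y. y \<in> {a..b} \<Longrightarrow> (\<phi> has_vector_derivative \<phi>1 y) (at y within {a..b})"
    and d2: "\<And>y. y \<in> {a..b} \<Longrightarrow> (\<phi>1 has_vector_derivative
       (complex_of_real (\<alpha>\<^sup>2) - complex_of_real (\<beta> - U2 y) / (complex_of_real (U y) - c)) * \<phi> y)
       (at y within {a..b})"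
    and ends: "\<phi> a = 0" "\<phi> b = 0"
    and quad: "\<And>y. y \<in> {a..b} \<Longrightarrow> (\<beta> - U2 y) * (U y - 2 * Re c + u)
       \<le> M * (U y - Re c)\<^sup>2 - \<kappa> * (u - Re c)\<^sup>2 * (\<beta> - U2 y)\<^sup>2"
    and "M > 0"
  shows "\<kappa> * (u - Re c)\<^sup>2 * integral {a..b} (\<lambda>y. (cmod (complex_of_real (\<beta> - U2 y) / (complex_of_real (U y) - c) * \<phi> y))\<^sup>2)
    \<le> M * integral {a..b} (\<lambda>y. (cmod (\<phi> y))\<^sup>2)"
proof -
  have nz: "complex_of_real (U y) - c \<noteq> 0" for y using \<open>Im c > 0\<close> by (auto simp: complex_eq_iff)
  have contphi: "continuous_on {a..b} \<phi>" by (rule continuous_on_vector_derivative[where f'=\<phi>1]) (rule d1)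
  let ?V = "\<lambda>y. complex_of_real (\<beta> - U2 y) / (complex_of_real (U y) - c)"
  \<comment> \<open>This \<open>l\<close> makes the real part of
    \<open>Complex 1 (-l) / (U y - c)\<close> equal to \<open>U y - 2 * Re c + u\<close> divided by
    the squared modulus of \<open>U y - c\<close>, which is the combination in \<open>quad\<close>.
    It may blow up as \<open>Im c\<close> tends to 0, but does not occur in the resulting
    bound.\<close>
  define l where "l = (u - Re c) / Im c"
  define F where "F = (\<lambda>y. Re (Complex 1 (-l) * (\<phi>1 y * cnj (\<phi> y))))"
  define F' where "F' = (\<lambda>y. Re (Complex 1 (-l) * ((complex_of_real (\<alpha>\<^sup>2) - ?V y) * \<phi> y * cnj (\<phi> y) + \<phi>1 y * cnj (\<phi>1 y))))"
  define f where "f = (\<lambda>y. \<kappa> * (u - Re c)\<^sup>2 * (cmod (?V y * \<phi> y))\<^sup>2 - M * (cmod (\<phi> y))\<^sup>2)"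
  have "(F has_vector_derivative F' y) (at y within {a..b})" if y: "y \<in> {a..b}" for y
  proof -
    have "((\<lambda>y. \<phi>1 y * cnj (\<phi> y)) has_vector_derivative
        (\<phi>1 y * cnj (\<phi>1 y) + (complex_of_real (\<alpha>\<^sup>2) - ?V y) * \<phi> y * cnj (\<phi> y))) (at y within {a..b})"
      by (rule has_vector_derivative_mult[OF d2[OF y] bounded_linear.has_vector_derivative[OF bounded_linear_cnj d1[OF y]]])
    from bounded_linear.has_vector_derivative[OF bounded_linear_Re has_vector_derivative_mult_right[OF this, of "Complex 1 (-l)"]]
    show ?thesis unfolding F_def F'_def by (simp only: add.commute)
  qed
  then have "(F' has_integral (F b - F a)) {a..b}"
    using \<open>a < b\<close> by (intro fundamental_theorem_of_calculus) auto
  then have F'int: "(F' has_integral 0) {a..b}" by (simp add: F_def ends)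
  have i1: "(\<lambda>y. (cmod (?V y * \<phi> y))\<^sup>2) integrable_on {a..b}"
    and i2: "(\<lambda>y. (cmod (\<phi> y))\<^sup>2) integrable_on {a..b}"
    by (intro integrable_continuous_interval continuous_intros contphi U U2; use nz in auto)+
  have "f y \<le> F' y" if y: "y \<in> {a..b}" for y
  proof -
    let ?x = "U y - Re c" and ?N = "(U y - Re c)\<^sup>2 + (Im c)\<^sup>2" and ?W = "\<beta> - U2 y"
    have N: "?N > 0" using \<open>Im c > 0\<close> by (simp add: add_nonneg_pos)
    have N2: "(cmod (complex_of_real (U y) - c))\<^sup>2 = ?N" by (simp add: cmod_power2)
    have "F' y = \<alpha>\<^sup>2 * (cmod (\<phi> y))\<^sup>2 + (cmod (\<phi>1 y))\<^sup>2 - Re (Complex 1 (-l) * ?V y) * (cmod (\<phi> y))\<^sup>2"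
    proof -
      have re: "Re (z * complex_of_real t) = Re z * t" for z t by simp
      have "Complex 1 (-l) * ((complex_of_real (\<alpha>\<^sup>2) - ?V y) * \<phi> y * cnj (\<phi> y) + \<phi>1 y * cnj (\<phi>1 y))
        = Complex 1 (-l) * complex_of_real (\<alpha>\<^sup>2 * (cmod (\<phi> y))\<^sup>2) + Complex 1 (-l) * complex_of_real ((cmod (\<phi>1 y))\<^sup>2)
          - (Complex 1 (-l) * ?V y) * complex_of_real ((cmod (\<phi> y))\<^sup>2)"
        unfolding mult.assoc complex_norm_square[symmetric] of_real_mult by (simp only: algebra_simps)
      then show ?thesis unfolding F'_def by (simp only: re plus_complex.sel minus_complex.sel complex.sel)
    qed
    also have "Re (Complex 1 (-l) * ?V y) = ?W * (U y - 2 * Re c + u) / ?N"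
    proof -
      have "Complex 1 (-l) * ?V y = complex_of_real (?W / ?N) * (Complex 1 (-l) * cnj (complex_of_real (U y) - c))"
        unfolding complex_div_cnj[of "complex_of_real ?W" "complex_of_real (U y) - c"] N2 of_real_divide by simp
      then have "Re (Complex 1 (-l) * ?V y) = ?W / ?N * Re (Complex 1 (-l) * cnj (complex_of_real (U y) - c))"
        by (simp only: Re_complex_of_real Im_complex_of_real times_complex.sel(1)[of "complex_of_real _"] mult_zero_left diff_zero)
      also have "Re (Complex 1 (-l) * cnj (complex_of_real (U y) - c)) = U y - 2 * Re c + u"
        using \<open>Im c > 0\<close> by (simp add: l_def)
      finally show ?thesis by simp
    qed
    finally have F'y: "F' y = \<alpha>\<^sup>2 * (cmod (\<phi> y))\<^sup>2 + (cmod (\<phi>1 y))\<^sup>2 - ?W * (U y - 2 * Re c + u) / ?N * (cmod (\<phi> y))\<^sup>2" .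
    \<comment> \<open>Adding \<open>M * (Im c)\<^sup>2\<close> replaces
      \<open>(U y - Re c)\<^sup>2\<close> by \<open>?N\<close>, which cancels against the
      denominator.\<close>
    have "?W * (U y - 2 * Re c + u) \<le> M * ?N - \<kappa> * (u - Re c)\<^sup>2 * ?W\<^sup>2"
    proof -
      have "M * (Im c)\<^sup>2 \<ge> 0" using \<open>M > 0\<close> by simp
      then show ?thesis using quad[OF y] distrib_left[of M "?x\<^sup>2" "(Im c)\<^sup>2"] by linarith
    qed
    then have "?W * (U y - 2 * Re c + u) / ?N \<le> (M * ?N - \<kappa> * (u - Re c)\<^sup>2 * ?W\<^sup>2) / ?N"
      using N by (intro divide_right_mono) auto
    also have "\<dots> = M - \<kappa> * (u - Re c)\<^sup>2 * (?W\<^sup>2 / ?N)" using \<open>Im c > 0\<close> by (simp only: diff_divide_distrib) simp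
    finally have "?W * (U y - 2 * Re c + u) / ?N * (cmod (\<phi> y))\<^sup>2 \<le> (M - \<kappa> * (u - Re c)\<^sup>2 * (?W\<^sup>2 / ?N)) * (cmod (\<phi> y))\<^sup>2"
      by (rule mult_right_mono) simp
    moreover have "f y = - ((M - \<kappa> * (u - Re c)\<^sup>2 * (?W\<^sup>2 / ?N)) * (cmod (\<phi> y))\<^sup>2)"
      unfolding f_def norm_mult norm_divide power_mult_distrib power_divide N2
      by (simp only: norm_of_real power2_abs left_diff_distrib minus_diff_eq mult.assoc)
    moreover have "\<alpha>\<^sup>2 * (cmod (\<phi> y))\<^sup>2 \<ge> 0" "(cmod (\<phi>1 y))\<^sup>2 \<ge> 0" by auto
    ultimately show ?thesis unfolding F'y by linarith
  qed
  moreover have "(f has_integral (\<kappa> * (u - Re c)\<^sup>2 * integral {a..b} (\<lambda>y. (cmod (?V y * \<phi> y))\<^sup>2)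
      - M * integral {a..b} (\<lambda>y. (cmod (\<phi> y))\<^sup>2))) {a..b}"
    unfolding f_def
    by (intro has_integral_diff has_integral_mult_right integrable_integral i1 i2)
  ultimately have "\<kappa> * (u - Re c)\<^sup>2 * integral {a..b} (\<lambda>y. (cmod (?V y * \<phi> y))\<^sup>2)
      - M * integral {a..b} (\<lambda>y. (cmod (\<phi> y))\<^sup>2) \<le> 0"
    using F'int by (blast intro: has_integral_le)
  then show ?thesis by simp
qed

section \<open>Passage to the limit\<close>

text \<open>Young's inequality \<open>x \<le> t * x\<^sup>2 + 1 / t\<close> in place of
  Cauchy-Schwarz. With \<open>t\<close> chosen small first and \<open>y - x\<close> small
  afterwards, a bound on the square integral yields equicontinuity.\<close>

lemma norm_integral_le_quadratic:
  fixes f :: "real \<Rightarrow> 'a :: euclidean_space"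
  assumes f: "continuous_on {x..y} f" and "x \<le> y" "t > 0"
  shows "norm (integral {x..y} f) \<le> t * integral {x..y} (\<lambda>s. (norm (f s))\<^sup>2) + (y - x) / t"
proof -
  have i: "(\<lambda>s. (norm (f s))\<^sup>2) integrable_on {x..y}"
    by (intro integrable_continuous_interval continuous_intros f)
  have "((\<lambda>s. t * (norm (f s))\<^sup>2 + 1 / t) has_integral
      (t * integral {x..y} (\<lambda>s. (norm (f s))\<^sup>2) + (y - x) / t)) {x..y}"
    using has_integral_add[OF has_integral_mult_right[OF integrable_integral[OF i], of t]
        has_integral_const_real[of "1 / t" x y]] \<open>x \<le> y\<close> by simp
  moreover have "norm (f s) \<le> t * (norm (f s))\<^sup>2 + 1 / t" for s
  proof -
    have "0 \<le> (t * norm (f s) - 1)\<^sup>2 / t + norm (f s)" using \<open>t > 0\<close> by simp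
    also have "\<dots> = t * (norm (f s))\<^sup>2 + 1 / t - norm (f s)"
      using \<open>t > 0\<close> by (simp add: field_simps power2_eq_square)
    finally show ?thesis by simp
  qed
  ultimately show ?thesis
    using integral_norm_bound_integral[of f "{x..y}" "\<lambda>s. t * (norm (f s))\<^sup>2 + 1 / t"]
      integrable_continuous_interval[OF f] by (auto simp: has_integral_iff)
qed

text \<open>The bound on \<open>w\<close> makes the \<open>\<psi> n\<close> equicontinuous and the
  Dirichlet conditions make them bounded, so Arzela-Ascoli applies to \<open>\<psi>\<close>.
  Integration from \<open>a\<close>, where every \<open>\<phi> n\<close> vanishes, transfers the
  convergence to \<open>\<phi>\<close>.\<close>

lemma dirichlet_H2_bounded_imp_C1_subsequence:
  fixes \<phi> \<psi> w :: "nat \<Rightarrow> real \<Rightarrow> complex"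
  assumes "a < b"
    and d1: "\<And>n y. y \<in> {a..b} \<Longrightarrow> (\<phi> n has_vector_derivative \<psi> n y) (at y within {a..b})"
    and d2: "\<And>n y. y \<in> {a..b} \<Longrightarrow> (\<psi> n has_vector_derivative w n y) (at y within {a..b})"
    and w: "\<And>n. continuous_on {a..b} (w n)"
    and ends: "\<And>n. \<phi> n a = 0" "\<And>n. \<phi> n b = 0"
    and bd: "\<And>n. integral {a..b} (\<lambda>y. (cmod (w n y))\<^sup>2) \<le> B"
  obtains r \<Phi> g where "strict_mono (r :: nat \<Rightarrow> nat)" "continuous_on {a..b} g"
    "\<And>y. y \<in> {a..b} \<Longrightarrow> (\<Phi> has_vector_derivative g y) (at y within {a..b})"
    "uniform_limit {a..b} (\<lambda>n. \<phi> (r n)) \<Phi> sequentially"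
    "uniform_limit {a..b} (\<lambda>n. \<psi> (r n)) g sequentially"
proof -
  have contpsi: "continuous_on {a..b} (\<psi> n)" for n
    by (rule continuous_on_vector_derivative[where f'="w n"]) (rule d2)
  have iw: "(\<lambda>s. (norm (w n s))\<^sup>2) integrable_on S" if "S = {x..y}" "{x..y} \<subseteq> {a..b}" for n S x y
    unfolding that(1)
    by (intro integrable_continuous_interval continuous_intros continuous_on_subset[OF w that(2)])
  have "B \<ge> 0"
    by (rule order_trans[OF _ bd[of 0]]) (rule integral_nonneg, use iw[of "{a..b}"] in auto)
  have le: "norm (\<psi> n y - \<psi> n x) \<le> t * B + (y - x) / t"
    if "x \<in> {a..b}" "y \<in> {a..b}" "x \<le> y" "t > 0" for n x y t
  proof -
    have sub: "{x..y} \<subseteq> {a..b}" using that by auto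
    have "(w n has_integral (\<psi> n y - \<psi> n x)) {x..y}"
      using that sub by (intro fundamental_theorem_of_calculus)
        (auto intro!: has_vector_derivative_within_subset[OF d2 sub])
    then have "norm (\<psi> n y - \<psi> n x) \<le> t * integral {x..y} (\<lambda>s. (norm (w n s))\<^sup>2) + (y - x) / t"
      using norm_integral_le_quadratic[OF continuous_on_subset[OF w sub] \<open>x \<le> y\<close> \<open>t > 0\<close>, of n]
      by (simp add: has_integral_iff)
    also have "integral {x..y} (\<lambda>s. (norm (w n s))\<^sup>2) \<le> integral {a..b} (\<lambda>s. (norm (w n s))\<^sup>2)"
      by (intro integral_subset_le sub iw[OF refl sub] iw[OF refl order_refl]) auto
    also have "\<dots> \<le> B" by (rule bd)
    finally show ?thesis using \<open>t > 0\<close> by (simp add: mult_left_mono)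
  qed
  have le': "norm (\<psi> n y - \<psi> n x) \<le> t * B + \<bar>y - x\<bar> / t"
    if "x \<in> {a..b}" "y \<in> {a..b}" "t > 0" for n x y t
    using le[OF that(1,2) _ that(3), of n] le[OF that(2,1) _ that(3), of n]
    by (cases "x \<le> y") (auto simp: norm_minus_commute)
  have int1: "(\<psi> n has_integral \<phi> n y) {a..y}" if "y \<in> {a..b}" for n y
  proof -
    have sub: "{a..y} \<subseteq> {a..b}" using that by auto
    have "(\<psi> n has_integral (\<phi> n y - \<phi> n a)) {a..y}"
      using that sub by (intro fundamental_theorem_of_calculus)
        (auto intro!: has_vector_derivative_within_subset[OF d1 sub])
    then show ?thesis using ends by simp
  qed
  \<comment> \<open>Since \<open>\<phi> n\<close> vanishes at both ends, \<open>\<psi> n\<close> has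
    mean 0; its value at \<open>x\<close> is thus the average of
    \<open>\<psi> n x - \<psi> n y\<close> over \<open>y\<close>, bounded by \<open>le'\<close> with
    \<open>t = 1\<close>.\<close>
  have bnd: "norm (\<psi> n x) \<le> B + (b - a)" if x: "x \<in> {a..b}" for n x
  proof -
    have b: "b \<in> {a..b}" using \<open>a < b\<close> by simp
    have "((\<lambda>y. \<psi> n x - \<psi> n y) has_integral ((b - a) *\<^sub>R \<psi> n x - \<phi> n b)) {a..b}"
      using has_integral_diff[OF has_integral_const_real[of "\<psi> n x" a b] int1[OF b, of n]] \<open>a < b\<close> by simp
    then have "integral {a..b} (\<lambda>y. \<psi> n x - \<psi> n y) = (b - a) *\<^sub>R \<psi> n x"
      using ends by (simp add: has_integral_iff)
    moreover have "norm (integral {a..b} (\<lambda>y. \<psi> n x - \<psi> n y)) \<le> (B + (b - a)) * (b - a)"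
    proof (rule integral_bound)
      show "continuous_on {a..b} (\<lambda>y. \<psi> n x - \<psi> n y)" by (intro continuous_intros contpsi)
      fix y assume y: "y \<in> {a..b}"
      have "norm (\<psi> n x - \<psi> n y) \<le> 1 * B + \<bar>x - y\<bar> / 1" by (rule le') (use x y in auto)
      also have "\<dots> \<le> B + (b - a)" using x y by auto
      finally show "norm (\<psi> n x - \<psi> n y) \<le> B + (b - a)" .
    qed (use \<open>a < b\<close> in simp)
    ultimately have "(b - a) * norm (\<psi> n x) \<le> (b - a) * (B + (b - a))"
      using \<open>a < b\<close> by (simp add: mult.commute)
    then show ?thesis using \<open>a < b\<close> by simp
  qed
  have equi: "\<exists>d>0. \<forall>n y. y \<in> {a..b} \<and> norm (x - y) < d \<longrightarrow> norm (\<psi> n x - \<psi> n y) < e"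
    if x: "x \<in> {a..b}" and "0 < e" for x e
  proof -
    \<comment> \<open>The term \<open>t * B\<close> is brought below \<open>e / 2\<close> first; the
      radius \<open>t * e / 2\<close> then takes care of
      \<open>\<bar>x - y\<bar> / t\<close>.\<close>
    define t where "t = e / (2 * (B + 1))"
    have t: "t > 0" using \<open>0 < e\<close> \<open>B \<ge> 0\<close> by (simp add: t_def)
    have tB: "t * B < e / 2" using \<open>0 < e\<close> \<open>B \<ge> 0\<close> by (simp add: t_def field_simps)
    show ?thesis
    proof (intro exI[of _ "t * e / 2"] conjI allI impI)
      fix n y assume y: "y \<in> {a..b} \<and> norm (x - y) < t * e / 2"
      have "norm (\<psi> n x - \<psi> n y) \<le> t * B + \<bar>x - y\<bar> / t" by (rule le') (use x y t in auto)
      moreover have "\<bar>x - y\<bar> / t < e / 2" using y t by (simp add: field_simps)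
      ultimately show "norm (\<psi> n x - \<psi> n y) < e" using tB by linarith
    qed (use t \<open>0 < e\<close> in simp)
  qed
  obtain g r where g: "continuous_on {a..b} g" "strict_mono (r :: nat \<Rightarrow> nat)"
    "\<And>e. 0 < e \<Longrightarrow> \<exists>N. \<forall>n x. n \<ge> N \<and> x \<in> {a..b} \<longrightarrow> norm (\<psi> (r n) x - g x) < e"
    by (rule Arzela_Ascoli[of "{a..b}" \<psi> "B + (b - a)", OF compact_Icc bnd equi])
       (assumption+, rule that, assumption, assumption, blast)
  have ulg: "uniform_limit {a..b} (\<lambda>n. \<psi> (r n)) g sequentially"
    unfolding uniform_limit_sequentially_iff dist_norm using g(3) by blast
  define \<Phi> where "\<Phi> = (\<lambda>y. integral {a..y} g)"
  have d\<Phi>: "(\<Phi> has_vector_derivative g y) (at y within {a..b})" if "y \<in> {a..b}" for y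
    unfolding \<Phi>_def by (rule integral_has_vector_derivative[OF g(1) that])
  have "uniform_limit {a..b} (\<lambda>n. \<phi> (r n)) \<Phi> sequentially"
    unfolding uniform_limit_sequentially_iff dist_norm
  proof (intro allI impI)
    fix e :: real assume "e > 0"
    define e' where "e' = e / 2 / (b - a)"
    have e': "e' > 0" using \<open>e > 0\<close> \<open>a < b\<close> by (simp add: e'_def)
    then obtain N where N: "\<And>n x. n \<ge> N \<Longrightarrow> x \<in> {a..b} \<Longrightarrow> norm (\<psi> (r n) x - g x) < e'"
      using g(3) by blast
    have "norm (\<phi> (r n) y - \<Phi> y) < e" if "n \<ge> N" and y: "y \<in> {a..b}" for n y
    proof -
      have sub: "{a..y} \<subseteq> {a..b}" using y by auto
      have "\<phi> (r n) y - \<Phi> y = integral {a..y} (\<lambda>s. \<psi> (r n) s - g s)"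
        unfolding \<Phi>_def using int1[OF y, of "r n"] integrable_continuous_interval[OF continuous_on_subset[OF g(1) sub]]
        by (simp add: has_integral_iff integral_diff)
      also have "norm \<dots> \<le> e' * (y - a)"
        by (rule integral_bound)
           (use y N \<open>n \<ge> N\<close> in \<open>auto intro!: continuous_intros continuous_on_subset[OF contpsi sub] continuous_on_subset[OF g(1) sub] less_imp_le\<close>)
      also have "\<dots> \<le> e' * (b - a)" using e' y by (intro mult_left_mono) auto
      also have "\<dots> < e"
      proof -
        have *: "e / 2 / l * l < e" if "l > 0" for l using that \<open>e > 0\<close> by simp
        show ?thesis unfolding e'_def by (rule *) (use \<open>a < b\<close> in simp)
      qed
      finally show ?thesis .
    qed
    then show "\<exists>N. \<forall>n\<ge>N. \<forall>x\<in>{a..b}. norm (\<phi> (r n) x - \<Phi> x) < e" by blast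
  qed
  then show thesis using that g d\<Phi> ulg by blast
qed

text \<open>On an interval of length \<open>\<bar>c n - cs\<bar>\<close> at \<open>z\<close> the weight \<open>1/\<bar>U - c n\<bar>\<^sup>2\<close> is of size
  \<open>1/\<bar>c n - cs\<bar>\<^sup>2\<close>, which a nonzero limit \<open>\<Phi> z\<close> cannot compensate.\<close>
lemma weighted_L2_bounded_imp_limit_zero:
  fixes U W :: "real \<Rightarrow> real" and \<phi> :: "nat \<Rightarrow> real \<Rightarrow> complex"
  assumes z: "a \<le> z" "z < b" "U z = cs" "W z \<noteq> 0"
    and U: "(U has_real_derivative D) (at z within {a..b})" "continuous_on {a..b} U"
    and W: "continuous_on {a..b} W"
    and c: "\<And>n. Im (c n) > 0" "c \<longlonglongrightarrow> complex_of_real cs"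
    and \<phi>: "\<And>n. continuous_on {a..b} (\<phi> n)" "uniform_limit {a..b} \<phi> \<Phi> sequentially"
    and bd: "\<And>n. integral {a..b} (\<lambda>y. (cmod (complex_of_real (W y) / (complex_of_real (U y) - c n) * \<phi> n y))\<^sup>2) \<le> C"
  shows "\<Phi> z = 0"
proof (rule ccontr)
  assume nz: "\<Phi> z \<noteq> 0"
  have zab: "z \<in> {a..b}" using z by simp
  have cont\<Phi>: "continuous_on {a..b} \<Phi>"
    by (rule uniform_limit_theorem[OF always_eventually \<phi>(2)]) (use \<phi>(1) in auto)
  define f where "f = (\<lambda>y. complex_of_real (W y) * \<Phi> y)"
  define m where "m = cmod (f z)"
  have "m > 0" using nz z by (simp add: m_def f_def)
  have contf: "continuous_on {a..b} f" unfolding f_def by (intro continuous_intros W cont\<Phi>)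
  obtain \<delta> where \<delta>: "\<delta> > 0" "\<And>y. y \<in> {a..b} \<Longrightarrow> dist y z < \<delta> \<Longrightarrow> dist (f y) (f z) < m / 2"
    using contf zab \<open>m > 0\<close> unfolding continuous_on_iff by (metis half_gt_zero)
  obtain \<delta>' where \<delta>': "\<delta>' > 0"
    "\<And>y. y \<in> {a..b} \<Longrightarrow> norm (y - z) < \<delta>' \<Longrightarrow> norm (U y - U z - D * (y - z)) \<le> 1 * norm (y - z)"
    using U(1) unfolding has_field_derivative_def has_derivative_within_alt by (metis zero_less_one)
  obtain BW where BW: "BW \<ge> 0" "\<And>y. y \<in> {a..b} \<Longrightarrow> \<bar>W y\<bar> \<le> BW"
    using continuous_on_Icc_bounded[OF W] by auto
  \<comment> \<open>On the interval of length \<open>\<epsilon> n\<close>, differentiability gives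
    \<open>\<bar>U y - cs\<bar> \<le> (\<bar>D\<bar> + 1) * \<epsilon> n\<close>, and replacing
    \<open>cs\<close> by \<open>c n\<close> costs one more \<open>\<epsilon> n\<close>.\<close>
  define L where "L = \<bar>D\<bar> + 2"
  define \<epsilon> where "\<epsilon> = (\<lambda>n. cmod (c n - complex_of_real cs))"
  have \<epsilon>pos: "\<epsilon> n > 0" for n using c(1)[of n] by (auto simp: \<epsilon>_def complex_eq_iff)
  have \<epsilon>0: "\<epsilon> \<longlonglongrightarrow> 0"
    using c(2) unfolding \<epsilon>_def by (simp add: LIM_zero tendsto_norm_zero)
  \<comment> \<open>The modulus of \<open>W y * \<phi> n y\<close> stays above \<open>m / 4\<close>:
    half of \<open>m\<close> is given up to continuity of \<open>f\<close>, a quarter to uniform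
    convergence. Integrating the squared quotient over length \<open>\<epsilon> n\<close> leaves
    \<open>(m / 4)\<^sup>2 / (L\<^sup>2 * \<epsilon> n) \<le> C\<close>.\<close>
  have key: "(m / 4)\<^sup>2 \<le> C * L\<^sup>2 * \<epsilon> n"
    if n: "\<epsilon> n < min (min \<delta> \<delta>') (b - z)" "\<forall>y\<in>{a..b}. dist (\<phi> n y) (\<Phi> y) < m / (4 * (BW + 1))" for n
  proof -
    let ?I = "{z..z + \<epsilon> n}" and ?q = "\<lambda>y. (cmod (complex_of_real (W y) / (complex_of_real (U y) - c n) * \<phi> n y))\<^sup>2"
    have sub: "?I \<subseteq> {a..b}" using z n by auto
    have nzd: "complex_of_real (U y) - c n \<noteq> 0" for y using c(1)[of n] by (auto simp: complex_eq_iff)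
    have contq: "continuous_on {a..b} ?q"
      by (intro continuous_intros W U \<phi>) (use nzd in auto)
    have lb: "(m / 4)\<^sup>2 / (L * \<epsilon> n)\<^sup>2 \<le> ?q y" if y: "y \<in> ?I" for y
    proof -
      have yab: "y \<in> {a..b}" using y sub by blast
      have "dist (f y) (f z) < m / 2" using \<delta>(2)[OF yab] y n by (auto simp: dist_real_def)
      then have fy: "cmod (f y) > m / 2"
        using norm_triangle_ineq2[of "f z" "f y"] by (simp add: dist_norm norm_minus_commute m_def)
      have "cmod (complex_of_real (W y) * (\<phi> n y - \<Phi> y)) \<le> BW * (m / (4 * (BW + 1)))"
        unfolding norm_mult using BW(1) BW(2)[OF yab] n(2) yab
        by (intro mult_mono) (auto simp: dist_norm less_imp_le)
      also have "\<dots> \<le> m / 4" using BW(1) \<open>m > 0\<close> by (simp add: field_simps)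
      finally have "cmod (complex_of_real (W y) * \<phi> n y - f y) \<le> m / 4"
        by (simp add: f_def algebra_simps)
      then have num: "m / 4 \<le> cmod (complex_of_real (W y) * \<phi> n y)"
        using fy norm_triangle_ineq2[of "f y" "complex_of_real (W y) * \<phi> n y"]
        by (simp add: norm_minus_commute)
      have "\<bar>U y - cs - D * (y - z)\<bar> \<le> \<bar>y - z\<bar>" using \<delta>'(2)[OF yab] y n z by auto
      then have "\<bar>U y - cs\<bar> \<le> \<bar>D * (y - z)\<bar> + \<bar>y - z\<bar>" by linarith
      also have "\<dots> = (\<bar>D\<bar> + 1) * \<bar>y - z\<bar>" by (simp only: abs_mult distrib_right mult_1)
      also have "\<dots> \<le> (\<bar>D\<bar> + 1) * \<epsilon> n" using y by (intro mult_left_mono) auto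
      finally have Uy: "\<bar>U y - cs\<bar> \<le> (\<bar>D\<bar> + 1) * \<epsilon> n" .
      have "cmod (complex_of_real (U y) - c n) \<le> cmod (complex_of_real (U y - cs)) + \<epsilon> n"
        using norm_triangle_ineq[of "complex_of_real (U y - cs)" "complex_of_real cs - c n"]
        by (simp add: \<epsilon>_def norm_minus_commute)
      then have den: "cmod (complex_of_real (U y) - c n) \<le> L * \<epsilon> n"
        using Uy unfolding norm_of_real by (simp add: L_def algebra_simps)
      have "(m / 4) / (L * \<epsilon> n) \<le> cmod (complex_of_real (W y) * \<phi> n y) / cmod (complex_of_real (U y) - c n)"
        using num den nzd[of y] \<open>m > 0\<close> by (intro frac_le) auto
      then have "((m / 4) / (L * \<epsilon> n))\<^sup>2 \<le> (cmod (complex_of_real (W y) * \<phi> n y) / cmod (complex_of_real (U y) - c n))\<^sup>2"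
        using \<open>m > 0\<close> \<epsilon>pos[of n] by (intro power_mono) (auto simp: L_def)
      then show ?thesis by (simp add: power_divide norm_mult norm_divide)
    qed
    have "(m / 4)\<^sup>2 / (L * \<epsilon> n)\<^sup>2 * \<epsilon> n = integral ?I (\<lambda>y. (m / 4)\<^sup>2 / (L * \<epsilon> n)\<^sup>2)"
      using \<epsilon>pos[of n] by simp
    also have "\<dots> \<le> integral ?I ?q"
      by (intro integral_le lb integrable_continuous_interval continuous_on_subset[OF contq sub]) auto
    also have "\<dots> \<le> integral {a..b} ?q"
      by (intro integral_subset_le sub integrable_continuous_interval continuous_on_subset[OF contq sub] contq) auto
    also have "\<dots> \<le> C" by (rule bd)
    finally have le: "(m / 4)\<^sup>2 / (L * \<epsilon> n)\<^sup>2 * \<epsilon> n \<le> C" .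
    have "L > 0" by (simp add: L_def)
    have "(m / 4)\<^sup>2 = ((m / 4)\<^sup>2 / (L * \<epsilon> n)\<^sup>2 * \<epsilon> n) * (L\<^sup>2 * \<epsilon> n)"
      using \<epsilon>pos[of n] \<open>L > 0\<close> by (simp add: power2_eq_square)
    also have "\<dots> \<le> C * (L\<^sup>2 * \<epsilon> n)" using le \<epsilon>pos[of n] by (intro mult_right_mono) auto
    finally show ?thesis by (simp add: mult.assoc)
  qed
  have "\<forall>\<^sub>F n in sequentially. \<epsilon> n < min (min \<delta> \<delta>') (b - z)"
    using \<epsilon>0 by (rule order_tendstoD) (use \<delta> \<delta>' z in auto)
  moreover have "\<forall>\<^sub>F n in sequentially. \<forall>y\<in>{a..b}. dist (\<phi> n y) (\<Phi> y) < m / (4 * (BW + 1))"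
    by (rule uniform_limitD[OF \<phi>(2)]) (use \<open>m > 0\<close> BW in auto)
  ultimately have "\<forall>\<^sub>F n in sequentially. (m / 4)\<^sup>2 \<le> C * L\<^sup>2 * \<epsilon> n"
    by eventually_elim (rule key)
  moreover have "(\<lambda>n. C * L\<^sup>2 * \<epsilon> n) \<longlonglongrightarrow> C * L\<^sup>2 * 0" by (intro tendsto_intros \<epsilon>0)
  ultimately have "(m / 4)\<^sup>2 \<le> C * L\<^sup>2 * 0"
    by (metis tendsto_lowerbound trivial_limit_sequentially)
  then show False using \<open>m > 0\<close> by (simp add: power2_eq_square mult_le_0_iff)
qed

lemma uniform_limit_const_in_space:
  assumes "(f \<longlongrightarrow> l) F"
  shows "uniform_limit S (\<lambda>n _. f n) (\<lambda>_. l) F"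
  unfolding uniform_limit_iff
proof (intro allI impI)
  fix e :: real assume "e > 0"
  show "\<forall>\<^sub>F n in F. \<forall>x\<in>S. dist (f n) l < e"
    using tendstoD[OF assms \<open>e > 0\<close>] by eventually_elim blast
qed

text \<open>On a short root-free interval around \<open>y\<close> the right-hand sides converge
  uniformly. The limit is taken in the integrated equation, and the fundamental theorem of calculus
  turns the result back into a derivative.\<close>

lemma limit_ode:
  fixes U W :: "real \<Rightarrow> real" and \<phi> \<psi> :: "nat \<Rightarrow> real \<Rightarrow> complex"
  assumes U: "continuous_on {a..b} U" and W: "continuous_on {a..b} W"
    and c: "\<And>n. Im (c n) > 0" "c \<longlonglongrightarrow> complex_of_real cs"
    and \<alpha>: "\<alpha> \<longlonglongrightarrow> \<alpha>s"
    and \<phi>: "\<And>n. continuous_on {a..b} (\<phi> n)" "uniform_limit {a..b} \<phi> \<Phi> sequentially"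
    and \<psi>: "uniform_limit {a..b} \<psi> g sequentially"
    and d2: "\<And>n y. y \<in> {a..b} \<Longrightarrow> (\<psi> n has_vector_derivative
       (complex_of_real ((\<alpha> n)\<^sup>2) - complex_of_real (W y) / (complex_of_real (U y) - c n)) * \<phi> n y)
       (at y within {a..b})"
    and y: "y \<in> {a<..<b}" "U y \<noteq> cs"
  shows "(g has_vector_derivative
       (complex_of_real (\<alpha>s\<^sup>2) - complex_of_real (W y) / complex_of_real (U y - cs)) * \<Phi> y) (at y)"
proof -
  let ?w = "\<lambda>n y. (complex_of_real ((\<alpha> n)\<^sup>2) - complex_of_real (W y) / (complex_of_real (U y) - c n)) * \<phi> n y"
  let ?v = "\<lambda>y. (complex_of_real (\<alpha>s\<^sup>2) - complex_of_real (W y) / (complex_of_real (U y) - complex_of_real cs)) * \<Phi> y"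
  have cont\<Phi>: "continuous_on {a..b} \<Phi>"
    by (rule uniform_limit_theorem[OF always_eventually \<phi>(2)]) (use \<phi>(1) in auto)
  \<comment> \<open>\<open>U\<close> will vary by less than half of
    \<open>\<bar>U y - cs\<bar>\<close>, so \<open>\<bar>U - cs\<bar> \<ge> \<eta>\<close> on
    \<open>{p..q}\<close>; uniform convergence of the quotients rests on this.\<close>
  define \<eta> where "\<eta> = \<bar>U y - cs\<bar> / 2"
  have "\<eta> > 0" using y by (simp add: \<eta>_def)
  have yab: "y \<in> {a..b}" using y by simp
  obtain \<delta> where \<delta>: "\<delta> > 0" "\<And>x. x \<in> {a..b} \<Longrightarrow> dist x y < \<delta> \<Longrightarrow> dist (U x) (U y) < \<eta>"
    using U yab \<open>\<eta> > 0\<close> unfolding continuous_on_iff by metis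
  define \<epsilon> where "\<epsilon> = min (\<delta> / 2) (min (y - a) (b - y))"
  have \<epsilon>: "\<epsilon> > 0" "\<epsilon> < \<delta>" "\<epsilon> \<le> y - a" "\<epsilon> \<le> b - y" using \<delta>(1) y by (auto simp: \<epsilon>_def min_def)
  define p where "p = y - \<epsilon>"
  define q where "q = y + \<epsilon>"
  have sub: "{p..q} \<subseteq> {a..b}" using \<epsilon> by (auto simp: p_def q_def)
  have ypq: "y \<in> {p<..<q}" using \<epsilon> by (auto simp: p_def q_def)
  then have ypq': "y \<in> {p..q}" by simp
  have away: "\<eta> \<le> cmod (complex_of_real (U x) - complex_of_real cs)" if "x \<in> {p..q}" for x
  proof -
    have "dist (U x) (U y) < \<eta>" using \<delta>(2)[of x] that sub \<epsilon> by (auto simp: p_def q_def dist_real_def)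
    moreover have "\<bar>U y - cs\<bar> \<le> \<bar>U x - U y\<bar> + \<bar>U x - cs\<bar>" by linarith
    ultimately have "\<eta> \<le> \<bar>U x - cs\<bar>" by (simp add: dist_real_def \<eta>_def)
    then show ?thesis by (metis norm_of_real of_real_diff)
  qed
  have bdd: "bounded (f ` {p..q})" if "continuous_on {p..q} f" for f :: "real \<Rightarrow> complex"
    using compact_imp_bounded[OF compact_continuous_image[OF that compact_Icc]] .
  have contW: "continuous_on {p..q} W" and contU: "continuous_on {p..q} U" and cont\<Phi>': "continuous_on {p..q} \<Phi>"
    using continuous_on_subset[OF _ sub] W U cont\<Phi> by auto
  have contV: "continuous_on {p..q} (\<lambda>x. complex_of_real (\<alpha>s\<^sup>2) - complex_of_real (W x) / (complex_of_real (U x) - complex_of_real cs))"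
    by (intro continuous_intros contW contU) (use away \<open>\<eta> > 0\<close> in fastforce)
  have contv: "continuous_on {p..q} ?v"
    by (intro continuous_on_mult contV cont\<Phi>')
  have ul: "uniform_limit {p..q} ?w ?v sequentially"
  proof (rule uniform_lim_mult)
    show "uniform_limit {p..q} (\<lambda>n x. complex_of_real ((\<alpha> n)\<^sup>2) - complex_of_real (W x) / (complex_of_real (U x) - c n))
       (\<lambda>x. complex_of_real (\<alpha>s\<^sup>2) - complex_of_real (W x) / (complex_of_real (U x) - complex_of_real cs)) sequentially"
    proof (intro uniform_limit_minus uniform_limit_const_in_space)
      show "(\<lambda>n. complex_of_real ((\<alpha> n)\<^sup>2)) \<longlonglongrightarrow> complex_of_real (\<alpha>s\<^sup>2)" by (intro tendsto_intros \<alpha>)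
      show "uniform_limit {p..q} (\<lambda>n x. complex_of_real (W x) / (complex_of_real (U x) - c n))
         (\<lambda>x. complex_of_real (W x) / (complex_of_real (U x) - complex_of_real cs)) sequentially"
        by (rule uniform_lim_divide[OF uniform_limit_const uniform_limit_minus[OF uniform_limit_const
                uniform_limit_const_in_space[OF c(2)]] _ away \<open>\<eta> > 0\<close>])
           (intro bdd continuous_intros contW)
    qed
    show "uniform_limit {p..q} \<phi> \<Phi> sequentially" by (rule uniform_limit_on_subset[OF \<phi>(2) sub])
  qed (intro bdd contV cont\<Phi>')+
  have nzd: "complex_of_real (U x) - c n \<noteq> 0" for x n using c(1)[of n] by (auto simp: complex_eq_iff)
  have contw: "continuous_on {a..b} (?w n)" for n
    by (intro continuous_intros W U \<phi>) (use nzd in auto)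
  have g: "g x = g p + integral {p..x} ?v" if x: "x \<in> {p..q}" for x
  proof -
    have subx: "{p..x} \<subseteq> {p..q}" "{p..x} \<subseteq> {a..b}" using x sub by auto
    obtain I J where IJ: "\<And>n. (?w n has_integral I n) {p..x}" "(?v has_integral J) {p..x}" "I \<longlonglongrightarrow> J"
      by (rule uniform_limit_integral[OF uniform_limit_on_subset[OF ul subx(1)] continuous_on_subset[OF contw subx(2)]
            trivial_limit_sequentially]) (rule that, blast, assumption, assumption)
    have In: "I n = \<psi> n x - \<psi> n p" for n
    proof -
      have "(?w n has_integral (\<psi> n x - \<psi> n p)) {p..x}"
      proof (rule fundamental_theorem_of_calculus)
        show "(\<psi> n has_vector_derivative ?w n s) (at s within {p..x})" if "s \<in> {p..x}" for s
          by (rule has_vector_derivative_within_subset[OF d2 subx(2)]) (use that subx in blast)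
      qed (use x in simp)
      then show ?thesis using IJ(1)[of n] by (rule has_integral_unique[symmetric])
    qed
    have "(\<lambda>n. \<psi> n x - \<psi> n p) \<longlonglongrightarrow> J" using IJ(3) unfolding In[symmetric] .
    moreover have "(\<lambda>n. \<psi> n x - \<psi> n p) \<longlonglongrightarrow> g x - g p"
      by (intro tendsto_diff tendsto_uniform_limitI[OF \<psi>]) (use x sub ypq in auto)
    ultimately have "J = g x - g p" by (rule LIMSEQ_unique)
    then show ?thesis using integral_unique[OF IJ(2)] by simp
  qed
  have "((\<lambda>x. g p + integral {p..x} ?v) has_vector_derivative ?v y) (at y within {p..q})"
    using integral_has_vector_derivative[OF contv, of y] ypq
      has_vector_derivative_add[OF has_vector_derivative_const] by fastforce
  then have "(g has_vector_derivative ?v y) (at y within {p..q})"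
    using has_vector_derivative_transform[of y "{p..q}" g, OF ypq' g] by blast
  moreover have "at y within {p..q} = at y" using ypq at_within_Icc_at[of p y q] by auto
  ultimately show ?thesis by (simp only: of_real_diff)
qed

section \<open>Contradiction from a regular value attained only in the interior\<close>

theorem theorem2p2:
  fixes a b :: real and U U1 U2 :: "real \<Rightarrow> real"
    and \<beta> cs \<alpha>s :: real and \<phi>s :: "real \<Rightarrow> complex"
  assumes "class_K_plus a b U U1 U2"
    and "(INF y\<in>{a..b}. U2 y) < \<beta>" and "\<beta> < (SUP y\<in>{a..b}. U2 y)"
    and "neutral_limiting_mode a b U U2 cs \<alpha>s \<beta> \<phi>s"
  shows "(\<exists>u\<in>U ` {a..b}. K_beta_pos_bdd a b U U2 \<beta> u \<and> cs = u)
       \<or> cs = U a \<or> cs = U b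
       \<or> (\<exists>y\<in>{a..b}. U1 y = 0 \<and> U y = cs)
       \<or> cs \<notin> U ` {a..b}"
proof (rule ccontr)
  assume neg: "\<not> ?thesis"
  obtain U3 where U: "\<And>y. y \<in> {a..b} \<Longrightarrow> (U has_real_derivative U1 y) (at y within {a..b})"
    and U1: "\<And>y. y \<in> {a..b} \<Longrightarrow> (U1 has_real_derivative U2 y) (at y within {a..b})"
    and U2: "\<And>y. y \<in> {a..b} \<Longrightarrow> (U2 has_real_derivative U3 y) (at y within {a..b})"
    using assms(1) unfolding class_K_plus_def C3_derivs_def by blast
  have contU: "continuous_on {a..b} U" and contU2: "continuous_on {a..b} U2"
    using U U2 by (meson DERIV_continuous continuous_on_eq_continuous_within)+
  obtain s t where st: "s \<in> {a..b}" "t \<in> {a..b}" "U s \<noteq> U t"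
    using assms(1) unfolding class_K_plus_def by blast
  have "a < b"
  proof (rule ccontr)
    assume "\<not> a < b"
    then have "s = t" using st by auto
    then show False using st by simp
  qed
  have ne: "{a..b} \<noteq> {}" using \<open>a < b\<close> by simp
  have bddU2: "bounded (U2 ` {a..b})"
    using compact_imp_bounded[OF compact_continuous_image[OF contU2 compact_Icc]] .
  obtain y1 where y1: "y1 \<in> {a..b}" "U2 y1 < \<beta>"
    using assms(2) cINF_less_iff[OF ne bounded_imp_bdd_below[OF bddU2]] by blast
  obtain y2 where y2: "y2 \<in> {a..b}" "\<beta> < U2 y2"
    using assms(3) less_cSUP_iff[OF ne bounded_imp_bdd_above[OF bddU2]] by blast
  \<comment> \<open>The intermediate value theorem puts \<open>\<beta>\<close> in the range of
    \<open>U2\<close>, so the class condition supplies a value \<open>u\<close>.\<close>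
  have "connected (U2 ` {a..b})" by (rule connected_continuous_image[OF contU2 connected_Icc])
  then have "\<beta> \<in> U2 ` {a..b}"
    by (rule connectedD_interval[of _ "U2 y1" "U2 y2"]) (use y1 y2 in auto)
  then obtain u where u: "u \<in> U ` {a..b}" "K_beta_pos_bdd a b U U2 \<beta> u"
    using assms(1) unfolding class_K_plus_def by blast
  \<comment> \<open>The negated conclusion leaves this picture: \<open>cs\<close> differs from
    \<open>u\<close>, is attained, and all roots of \<open>U - cs\<close> are simple and
    interior.\<close>
  have "cs \<noteq> u" using neg u by blast
  have csab: "cs \<noteq> U a" "cs \<noteq> U b" and csU: "cs \<in> U ` {a..b}"
    and reg: "\<And>y. y \<in> {a..b} \<Longrightarrow> U y = cs \<Longrightarrow> U1 y \<noteq> 0"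
    using neg by blast+
  have root_int: "y \<in> {a<..<b}" if "y \<in> {a..b}" "U y = cs" for y
    using that csab by (cases "y = a \<or> y = b") auto
  obtain z where z: "z \<in> {a..b}" "U z = cs" using csU by blast
  have "\<exists>x\<in>{a..b}. U x \<noteq> u" using st by metis
  then obtain M \<kappa> where M: "M > 0" and \<kappa>: "\<kappa> > 0"
    and quad: "\<And>y r. y \<in> {a..b} \<Longrightarrow>
      (\<beta> - U2 y) * (U y - 2 * r + u) \<le> M * (U y - r)\<^sup>2 - \<kappa> * (u - r)\<^sup>2 * (\<beta> - U2 y)\<^sup>2"
    using K_beta_quadratic_bound[OF U U1 contU2 _ u(2)] by blast
  let ?W = "\<lambda>y. \<beta> - U2 y"
  have contW: "continuous_on {a..b} ?W" by (intro continuous_intros contU2)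
  \<comment> \<open>At a root the positive quotient has the nonzero denominator
    \<open>cs - u\<close>, so its numerator cannot vanish. The weighted bound therefore really sees
    the root.\<close>
  have Wz: "?W y \<noteq> 0" if "y \<in> {a..b}" "U y = cs" for y
    using u(2) that \<open>cs \<noteq> u\<close> unfolding K_beta_pos_bdd_def by fastforce
  obtain c0 \<alpha>0 \<phi>0 where um0: "\<And>k. unstable_mode a b U U2 (c0 k) (\<alpha>0 k) \<beta> (\<phi>0 k)"
    and L20: "\<And>k. integral {a..b} (\<lambda>y. (cmod (\<phi>0 k y))\<^sup>2) = 1"
    and lim0: "c0 \<longlonglongrightarrow> complex_of_real cs" "\<alpha>0 \<longlonglongrightarrow> \<alpha>s" and "\<alpha>s > 0"
    using assms(4) unfolding neutral_limiting_mode_def Let_def by blast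
  define d where "d = \<bar>u - cs\<bar> / 2"
  have "d > 0" using \<open>cs \<noteq> u\<close> by (simp add: d_def)
  have "(\<lambda>k. \<bar>u - Re (c0 k)\<bar>) \<longlonglongrightarrow> \<bar>u - Re (complex_of_real cs)\<bar>"
    by (intro tendsto_intros lim0)
  then have "\<forall>\<^sub>F k in sequentially. d < \<bar>u - Re (c0 k)\<bar>"
    by (rule order_tendstoD) (use \<open>d > 0\<close> in \<open>simp add: d_def\<close>)
  then obtain N where N: "\<And>k. k \<ge> N \<Longrightarrow> d < \<bar>u - Re (c0 k)\<bar>"
    unfolding eventually_sequentially by blast
  obtain A where A: "\<And>k. \<bar>\<alpha>0 k\<bar> \<le> A"
    using convergent_imp_Bseq[OF convergentI[OF lim0(2)]] by (auto simp: Bseq_def)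
  \<comment> \<open>The first \<open>N\<close> modes are discarded so that \<open>Re (c k)\<close>
    keeps distance \<open>d\<close> from \<open>u\<close> for every \<open>k\<close>.\<close>
  define c where "c = (\<lambda>k. c0 (k + N))"
  define \<alpha> where "\<alpha> = (\<lambda>k. \<alpha>0 (k + N))"
  define \<phi> where "\<phi> = (\<lambda>k. \<phi>0 (k + N))"
  have um: "unstable_mode a b U U2 (c k) (\<alpha> k) \<beta> (\<phi> k)" and L2: "integral {a..b} (\<lambda>y. (cmod (\<phi> k y))\<^sup>2) = 1"
    and cd: "d < \<bar>u - Re (c k)\<bar>" and \<alpha>A: "\<bar>\<alpha> k\<bar> \<le> A" for k
    using um0 L20 N A by (auto simp: c_def \<alpha>_def \<phi>_def)
  have lim: "c \<longlonglongrightarrow> complex_of_real cs" "\<alpha> \<longlonglongrightarrow> \<alpha>s"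
    unfolding c_def \<alpha>_def by (intro LIMSEQ_ignore_initial_segment lim0)+
  have ci: "Im (c k) > 0" and cont\<phi>: "continuous_on {a..b} (\<phi> k)" and ends: "\<phi> k a = 0" "\<phi> k b = 0" for k
    using um[of k] by (auto simp: unstable_mode_def)
  let ?V = "\<lambda>k y. complex_of_real (\<beta> - U2 y) / (complex_of_real (U y) - c k)"
  let ?w = "\<lambda>k y. (complex_of_real ((\<alpha> k)\<^sup>2) - ?V k y) * \<phi> k y"
  have "\<forall>k. \<exists>\<psi>. (\<forall>y\<in>{a..b}. (\<phi> k has_vector_derivative \<psi> y) (at y within {a..b})) \<and>
      (\<forall>y\<in>{a..b}. (\<psi> has_vector_derivative ?w k y) (at y within {a..b}))"
  proof
    fix k
    show "\<exists>\<psi>. (\<forall>y\<in>{a..b}. (\<phi> k has_vector_derivative \<psi> y) (at y within {a..b})) \<and>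
      (\<forall>y\<in>{a..b}. (\<psi> has_vector_derivative ?w k y) (at y within {a..b}))"
      by (rule unstable_mode_C2_Icc[OF um \<open>a < b\<close> contU contU2]) blast
  qed
  then obtain \<psi> where "\<forall>k. (\<forall>y\<in>{a..b}. (\<phi> k has_vector_derivative \<psi> k y) (at y within {a..b})) \<and>
      (\<forall>y\<in>{a..b}. (\<psi> k has_vector_derivative ?w k y) (at y within {a..b}))"
    using choice[of "\<lambda>k \<psi>. (\<forall>y\<in>{a..b}. (\<phi> k has_vector_derivative \<psi> y) (at y within {a..b})) \<and>
      (\<forall>y\<in>{a..b}. (\<psi> has_vector_derivative ?w k y) (at y within {a..b}))"] by blast
  then have d1: "\<And>k y. y \<in> {a..b} \<Longrightarrow> (\<phi> k has_vector_derivative \<psi> k y) (at y within {a..b})"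
    and d2: "\<And>k y. y \<in> {a..b} \<Longrightarrow> (\<psi> k has_vector_derivative ?w k y) (at y within {a..b})"
    by blast+
  have nzd: "complex_of_real (U y) - c k \<noteq> 0" for y k using ci[of k] by (auto simp: complex_eq_iff)
  have contV\<phi>: "continuous_on {a..b} (\<lambda>y. ?V k y * \<phi> k y)" for k
    by (intro continuous_intros contU contU2 cont\<phi>) (use nzd in auto)
  have contw: "continuous_on {a..b} (?w k)" for k
    by (intro continuous_intros contU contU2 cont\<phi>) (use nzd in auto)
  \<comment> \<open>This is the weighted estimate for modes of unit mass, with
    \<open>(u - Re (c k))\<^sup>2\<close> replaced by its lower bound
    \<open>d\<^sup>2\<close>.\<close>
  define C where "C = M / (\<kappa> * d\<^sup>2)"
  have VL2: "integral {a..b} (\<lambda>y. (cmod (?V k y * \<phi> k y))\<^sup>2) \<le> C" for k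
  proof -
    let ?I = "integral {a..b} (\<lambda>y. (cmod (?V k y * \<phi> k y))\<^sup>2)"
    have "\<kappa> * (u - Re (c k))\<^sup>2 * ?I \<le> M * integral {a..b} (\<lambda>y. (cmod (\<phi> k y))\<^sup>2)"
      by (rule unstable_mode_weighted_L2_bound[OF \<open>a < b\<close> ci contU contU2 d1 d2 ends quad M])
    then have 1: "\<kappa> * (u - Re (c k))\<^sup>2 * ?I \<le> M" by (simp only: L2 mult_1_right)
    have "?I \<ge> 0"
      by (intro integral_nonneg integrable_continuous_interval continuous_on_power continuous_on_norm contV\<phi>) auto
    moreover have "d\<^sup>2 \<le> (u - Re (c k))\<^sup>2" using cd[of k] \<open>d > 0\<close> abs_le_square_iff[of d "u - Re (c k)"] by simp
    ultimately have "\<kappa> * d\<^sup>2 * ?I \<le> \<kappa> * (u - Re (c k))\<^sup>2 * ?I"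
      using \<kappa> by (intro mult_right_mono mult_left_mono) auto
    then have "?I * (\<kappa> * d\<^sup>2) \<le> M" using 1 by (simp only: mult.commute) 
    moreover have "\<kappa> * d\<^sup>2 > 0" using \<kappa> \<open>d > 0\<close> by simp
    ultimately show ?thesis unfolding C_def by (simp only: pos_le_divide_eq)
  qed
  have wL2: "integral {a..b} (\<lambda>y. (cmod (?w k y))\<^sup>2) \<le> 2 * A ^ 4 + 2 * C" for k
  proof -
    have i: "((\<lambda>y. (cmod (\<phi> k y))\<^sup>2) has_integral 1) {a..b}"
      "((\<lambda>y. (cmod (?V k y * \<phi> k y))\<^sup>2) has_integral integral {a..b} (\<lambda>y. (cmod (?V k y * \<phi> k y))\<^sup>2)) {a..b}"
      "((\<lambda>y. (cmod (?w k y))\<^sup>2) has_integral integral {a..b} (\<lambda>y. (cmod (?w k y))\<^sup>2)) {a..b}"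
      by (subst L2[of k, symmetric] | intro integrable_integral integrable_continuous_interval
          continuous_on_power continuous_on_norm contV\<phi> contw cont\<phi>)+
    have "(cmod (?w k y))\<^sup>2 \<le> 2 * A ^ 4 * (cmod (\<phi> k y))\<^sup>2 + 2 * (cmod (?V k y * \<phi> k y))\<^sup>2" for y
    proof -
      have "?w k y = complex_of_real ((\<alpha> k)\<^sup>2) * \<phi> k y - ?V k y * \<phi> k y" by (rule left_diff_distrib)
      then have "cmod (?w k y) \<le> (\<alpha> k)\<^sup>2 * cmod (\<phi> k y) + cmod (?V k y * \<phi> k y)"
        using norm_triangle_ineq4[of "complex_of_real ((\<alpha> k)\<^sup>2) * \<phi> k y" "?V k y * \<phi> k y"]
        by (simp only: norm_mult norm_of_real abs_power2)
      also have "(\<alpha> k)\<^sup>2 \<le> A\<^sup>2" using \<alpha>A[of k] abs_le_square_iff[of "\<alpha> k" A] by simp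
      finally have "cmod (?w k y) \<le> A\<^sup>2 * cmod (\<phi> k y) + cmod (?V k y * \<phi> k y)"
        by (simp add: mult_right_mono)
      then have "(cmod (?w k y))\<^sup>2 \<le> (A\<^sup>2 * cmod (\<phi> k y) + cmod (?V k y * \<phi> k y))\<^sup>2"
        by (rule power_mono) simp
      also have "\<dots> \<le> 2 * (A\<^sup>2 * cmod (\<phi> k y))\<^sup>2 + 2 * (cmod (?V k y * \<phi> k y))\<^sup>2"
      proof -
        have "(x + y)\<^sup>2 \<le> 2 * x\<^sup>2 + 2 * y\<^sup>2" for x y :: real
          using zero_le_power2[of "x - y"] by (simp add: power2_eq_square algebra_simps)
        then show ?thesis .
      qed
      also have "(A\<^sup>2 * cmod (\<phi> k y))\<^sup>2 = A ^ 4 * (cmod (\<phi> k y))\<^sup>2" by (simp add: power_mult_distrib)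
      finally show ?thesis by simp
    qed
    then have "integral {a..b} (\<lambda>y. (cmod (?w k y))\<^sup>2)
        \<le> 2 * A ^ 4 * 1 + 2 * integral {a..b} (\<lambda>y. (cmod (?V k y * \<phi> k y))\<^sup>2)"
      by (rule has_integral_le[OF i(3) has_integral_add[OF has_integral_mult_right[OF i(1)] has_integral_mult_right[OF i(2)]]])
    then show ?thesis using VL2[of k] by linarith
  qed
  obtain r \<Phi> g where r: "strict_mono (r :: nat \<Rightarrow> nat)" and contg: "continuous_on {a..b} g"
    and d\<Phi>: "\<And>y. y \<in> {a..b} \<Longrightarrow> (\<Phi> has_vector_derivative g y) (at y within {a..b})"
    and ul: "uniform_limit {a..b} (\<lambda>n. \<phi> (r n)) \<Phi> sequentially"
      "uniform_limit {a..b} (\<lambda>n. \<psi> (r n)) g sequentially"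
    by (rule dirichlet_H2_bounded_imp_C1_subsequence[OF \<open>a < b\<close> d1 d2 contw ends wL2]) 
       (assumption+, rule that)
  have limr: "(\<lambda>n. c (r n)) \<longlonglongrightarrow> complex_of_real cs" "(\<lambda>n. \<alpha> (r n)) \<longlonglongrightarrow> \<alpha>s"
    using LIMSEQ_subseq_LIMSEQ[OF lim(1) r] LIMSEQ_subseq_LIMSEQ[OF lim(2) r] by (simp_all add: o_def)
  have \<Phi>root: "\<Phi> y = 0" if y: "y \<in> {a..b}" "U y = cs" for y
    by (rule weighted_L2_bounded_imp_limit_zero[where W="?W" and c="\<lambda>n. c (r n)" and \<phi>="\<lambda>n. \<phi> (r n)",
          OF _ _ y(2) Wz[OF y] U[OF y(1)] contU contW ci limr(1) cont\<phi> ul(1) VL2])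
       (use root_int[OF y] in auto)
  have \<Phi>ends: "\<Phi> a = 0" "\<Phi> b = 0"
  proof -
    have "(\<lambda>n. \<phi> (r n) a) \<longlonglongrightarrow> \<Phi> a" "(\<lambda>n. \<phi> (r n) b) \<longlonglongrightarrow> \<Phi> b"
      by (rule tendsto_uniform_limitI[OF ul(1)], use \<open>a < b\<close> in simp)+
    then show "\<Phi> a = 0" "\<Phi> b = 0" by (simp_all add: ends LIMSEQ_const_iff)
  qed
  have ode: "(g has_vector_derivative complex_of_real (\<alpha>s\<^sup>2 - ?W y / (U y - cs)) * \<Phi> y) (at y)"
    if "y \<in> {a<..<b}" "U y \<noteq> cs" for y
    using limit_ode[where W="?W" and c="\<lambda>n. c (r n)" and \<phi>="\<lambda>n. \<phi> (r n)" and \<psi>="\<lambda>n. \<psi> (r n)" and \<alpha>="\<lambda>n. \<alpha> (r n)",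
          OF contU contW ci limr cont\<phi> ul d2 that]
    by (simp only: of_real_diff of_real_divide)
  \<comment> \<open>The limit equation has real coefficients, so real and imaginary part solve it
    separately; \<open>T\<close> stands for either of them.\<close>
  have lin0: "T (\<Phi> y) = 0" if T: "bounded_linear T" "\<And>x w. T (complex_of_real x * w) = x * T w" and y: "y \<in> {a..b}"
    for T :: "complex \<Rightarrow> real" and y
  proof (rule singular_dirichlet_solution_zero[where h="\<lambda>y. T (\<Phi> y)" and g="\<lambda>y. T (g y)" and \<alpha>=\<alpha>s and \<beta>=\<beta> and z=z
        and U=U and ?U1.0=U1 and ?U2.0=U2 and c=cs, OF \<open>a < b\<close> _ U U1 contU2 reg _ z(2) _ _ _ _ _ _ y])
    have "T 0 = 0" using bounded_linear.linear[OF T(1)] by (rule linear_0)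
    then show "T (\<Phi> a) = 0" "T (\<Phi> b) = 0" "\<And>y. y \<in> {a..b} \<Longrightarrow> U y = cs \<Longrightarrow> T (\<Phi> y) = 0"
      using \<Phi>ends \<Phi>root by auto
    show "((\<lambda>y. T (\<Phi> y)) has_real_derivative T (g y)) (at y within {a..b})" if "y \<in> {a..b}" for y
      using bounded_linear.has_vector_derivative[OF T(1) d\<Phi>[OF that]]
      by (simp add: has_real_derivative_iff_has_vector_derivative)
    show "continuous_on {a..b} (\<lambda>y. T (g y))" by (rule bounded_linear.continuous_on[OF T(1) contg])
    show "((\<lambda>y. T (g y)) has_real_derivative (\<alpha>s\<^sup>2 - (\<beta> - U2 y) / (U y - cs)) * T (\<Phi> y)) (at y)"
      if "y \<in> {a<..<b}" "U y \<noteq> cs" for y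
      using bounded_linear.has_vector_derivative[OF T(1) ode[OF that]]
      by (simp only: has_real_derivative_iff_has_vector_derivative T(2))
  qed (use \<open>\<alpha>s > 0\<close> root_int[OF z] in auto)
  have \<Phi>0: "\<Phi> y = 0" if "y \<in> {a..b}" for y
    using lin0[OF bounded_linear_Re _ that] lin0[OF bounded_linear_Im _ that] by (simp add: complex_eq_iff)
  \<comment> \<open>With \<open>e \<le> 1\<close> a mode below \<open>e\<close> in modulus has
    square at most \<open>e\<close>, and \<open>e * (b - a) < 1\<close>; this contradicts the unit
    mass once \<open>\<Phi>\<close> is 0.\<close>
  define e where "e = 1 / (2 * (b - a + 1))"
  have "e > 0" "e \<le> 1" using \<open>a < b\<close> by (auto simp: e_def)
  obtain n where n: "\<And>y. y \<in> {a..b} \<Longrightarrow> dist (\<phi> (r n) y) (\<Phi> y) < e"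
    using uniform_limitD[OF ul(1) \<open>e > 0\<close>] unfolding eventually_sequentially by blast
  have "norm (integral {a..b} (\<lambda>y. (cmod (\<phi> (r n) y))\<^sup>2)) \<le> e * (b - a)"
  proof (rule integral_bound)
    show "continuous_on {a..b} (\<lambda>y. (cmod (\<phi> (r n) y))\<^sup>2)"
      by (intro continuous_on_power continuous_on_norm cont\<phi>)
    fix y assume y: "y \<in> {a..b}"
    have "cmod (\<phi> (r n) y) \<le> e" using n[OF y] \<Phi>0[OF y] by simp
    then have "cmod (\<phi> (r n) y) * cmod (\<phi> (r n) y) \<le> e * 1" using \<open>e > 0\<close> \<open>e \<le> 1\<close> by (intro mult_mono) auto
    then show "norm ((cmod (\<phi> (r n) y))\<^sup>2) \<le> e" by (simp add: power2_eq_square)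
  qed (use \<open>a < b\<close> in simp)
  then have "1 \<le> e * (b - a)" by (simp add: L2)
  then show False using \<open>a < b\<close> by (simp add: e_def field_simps)
qed

end
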